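(* There exists an absolute constant $D$ such that the following holds. Let $k\ge1$ and $n$ be integers with $n\ge (k^3+2k^2+k)/2$ or $n\ge k^2/4+5k+D$. For each $i\in\{1,\dots,k\}$, let $m_i\ge 0$ be integers and let $\mathcal{F}_{i,j}\subseteq \binom{[n]}{k}$ for $1\le j\le m_i$. Suppose that any two distinct families $\mathcal{F}_{i,j}$ and $\mathcal{F}_{i',j'}$ (i.e. $(i,j)\neq(i',j')$) are cross-$\max\{i,i'\}$-intersecting. Put \[ M_s:=\max\!\left\{1,\sum_{r=1}^s m_r\right\}\qquad (0\le s\le k). \] Then \[ \sum_{i=1}^k\sum_{j=1}^{m_i}|\mathcal{F}_{i,j}| \le \max_{0\le s\le k}M_s\binom{n-s}{k-s}. \]
   Context: $\binom{[n]}{k}$ denotes the family of all $k$-element subsets of $[n]$. Two families $\mathcal{A},\mathcal{B}\subseteq\binom{[n]}{k}$ are cross-$t$-intersecting if $|A\cap B|\ge t$ for every $A\in\mathcal{A}$ and $B\in\mathcal{B}$. *)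

theory Defs
  imports Complex_Main "HOL-Library.Ramsey"
begin

definition cross_intersecting :: "nat \<Rightarrow> 'a set set \<Rightarrow> 'a set set \<Rightarrow> bool" where
  "cross_intersecting t \<A> \<B> \<longleftrightarrow> (\<forall>A\<in>\<A>. \<forall>B\<in>\<B>. card (A \<inter> B) \<ge> t)"

definition M_bound :: "(nat \<Rightarrow> nat) \<Rightarrow> nat \<Rightarrow> nat" where
  "M_bound m s = max 1 (\<Sum>r=1..s. m r)"

end

theory Submission
  imports Defs
begin

text \<open>
  Let \<open>d(A)\<close> be the number of families containing \<open>A\<close> and let the level of \<open>A\<close> be the least \<open>s\<close>
  with \<open>d(A) \<le> M\<^sub>s\<close>. A set of level \<open>s > 0\<close> lies in at least two families, one of them of index at
  least \<open>s\<close>, so it meets every set of the union in at least \<open>s\<close> elements. With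
  \<open>N\<^sub>s = (n - s) choose (k - s)\<close> it therefore suffices to show that the sum \<open>Z\<close> of the weights
  \<open>1 / N\<^sub>s\<close>, \<open>s = s(A)\<close>, is at most 1 for every family with levels \<open>s(A)\<close> such that \<open>card (A \<inter> A') \<ge> max (s(A)) (s(A'))\<close>.

  This is a weighted Lovasz theta bound. Let \<open>P\<^sub>t\<close> be the matrix from Wilson's proof of the
  Erdos-Ko-Rado theorem: it is the identity on pairs meeting in at least \<open>t\<close> elements, lies in the
  Johnson scheme, has eigenvalue \<open>N\<^sub>0 / N\<^sub>t\<close> on constants and vanishes on the next \<open>t\<close>
  eigenspaces. For the level indicators \<open>x\<^sub>s\<close> the form \<open>\<Sum> x\<^sub>s \<bullet> P\<^bsub>max s s'\<^esub> x\<^sub>s' / N\<^bsub>min s s'\<^esub>\<close> equals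
  \<open>Z\<close>, its constant part is \<open>Z\<^sup>2\<close>, and on every other eigenspace it is a kernel
  \<open>u\<^bsub>min s s'\<^esub> v\<^bsub>max s s'\<^esub>\<close>, which is positive semidefinite as soon as \<open>u / v\<close> is nondecreasing. Hence
  \<open>Z \<ge> Z\<^sup>2\<close>. The monotonicity reduces to a bound on Wilson's eigenvalues, which are iterated
  differences of a rational function; it holds for \<open>n \<ge> k\<^sup>2 / 4 + 5 k\<close>, so \<open>D = 0\<close> works.
\<close>

section \<open>Projections, kernels and binomial identities\<close>

text \<open>Gram-Schmidt, one vector at a time: \<open>a'\<close> is the part of \<open>u a\<close>
  orthogonal to the earlier vectors, and \<open>f'\<close> is corrected by its component along
  \<open>a'\<close>. The vectors \<open>u i\<close> may be linearly dependent.\<close>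

lemma orthogonal_projection_exists:
  fixes u :: "'i \<Rightarrow> 'a \<Rightarrow> real"
  assumes "finite I" and "finite X"
  shows "\<exists>c. \<forall>i\<in>I. (\<Sum>x\<in>X. (f x - (\<Sum>j\<in>I. c j * u j x)) * u i x) = 0"
  using assms(1)
proof (induction I arbitrary: f rule: finite_induct)
  case (insert a I)
  define ip where "ip g h = (\<Sum>x\<in>X. g x * h x)" for g h :: "'a \<Rightarrow> real"
  obtain c where c: "ip (\<lambda>x. f x - (\<Sum>j\<in>I. c j * u j x)) (u i) = 0" if "i \<in> I" for i
    using insert.IH[of f] unfolding ip_def by auto
  obtain b where b: "ip (\<lambda>x. u a x - (\<Sum>j\<in>I. b j * u j x)) (u i) = 0" if "i \<in> I" for i
    using insert.IH[of "u a"] unfolding ip_def by auto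
  define f' where "f' = (\<lambda>x. f x - (\<Sum>j\<in>I. c j * u j x))"
  define a' where "a' = (\<lambda>x. u a x - (\<Sum>j\<in>I. b j * u j x))"
  \<comment> \<open>If \<open>a'\<close> vanishes on \<open>X\<close>, then \<open>r\<close> is 0 by
    the convention \<open>x / 0 = 0\<close>, and orthogonality to \<open>a'\<close> is
    automatic.\<close>
  define r where "r = ip f' a' / ip a' a'"
  define g where "g = (\<lambda>x. f' x - r * a' x)"
  define c' where "c' j = (if j = a then r else c j - r * b j)" for j
  have lin: "ip (\<lambda>x. p x - q * s x) h = ip p h - q * ip s h" for p q s h
    by (simp add: ip_def sum_subtractf sum_distrib_left algebra_simps)
  have g_I: "ip g (u i) = 0" if "i \<in> I" for i
    unfolding g_def lin using c[OF that] b[OF that] by (simp add: f'_def a'_def)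
  have g_comb: "ip g (\<lambda>x. \<Sum>j\<in>I. b j * u j x) = 0"
  proof -
    have "ip g (\<lambda>x. \<Sum>j\<in>I. b j * u j x) = (\<Sum>x\<in>X. \<Sum>j\<in>I. b j * (g x * u j x))"
      by (simp add: ip_def sum_distrib_left algebra_simps)
    also have "\<dots> = (\<Sum>j\<in>I. b j * ip g (u j))"
      by (subst sum.swap) (simp add: ip_def sum_distrib_left)
    finally show ?thesis using g_I by simp
  qed
  have g_a': "ip g a' = 0"
  proof (cases "ip a' a' = 0")
    case True
    then have "a' x = 0" if "x \<in> X" for x
      using that \<open>finite X\<close> by (simp add: ip_def sum_nonneg_eq_0_iff)
    then show ?thesis by (simp add: ip_def)
  next
    case False
    have "ip g a' = ip f' a' - r * ip a' a'" unfolding g_def by (rule lin)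
    with False show ?thesis by (simp add: r_def)
  qed
  have "ip g (u a) = ip g a' + ip g (\<lambda>x. \<Sum>j\<in>I. b j * u j x)"
    by (simp add: ip_def a'_def sum.distrib[symmetric] algebra_simps)
  with g_a' g_comb have g_a: "ip g (u a) = 0" by simp
  have "f x - (\<Sum>j\<in>insert a I. c' j * u j x) = g x" for x
  proof -
    have "(\<Sum>j\<in>I. c' j * u j x) = (\<Sum>j\<in>I. c j * u j x - r * (b j * u j x))"
      using insert.hyps by (intro sum.cong) (auto simp: c'_def algebra_simps)
    then show ?thesis using insert.hyps
      by (simp add: c'_def g_def f'_def a'_def sum_subtractf sum_distrib_left algebra_simps)
  qed
  then show ?case using g_I g_a unfolding ip_def by (intro exI[of _ c']) auto
qed auto

text \<open>Abel summation in disguise: the form exceeds that of the constant kernel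
  \<open>r 0\<close> by the nonnegative increments of \<open>r\<close> times squares of tail sums of
  \<open>y\<close>. The induction splits off index 0 and leaves the shifted kernel on the
  rest.\<close>

lemma min_kernel_ge:
  fixes r y :: "nat \<Rightarrow> real"
  assumes "\<And>s. Suc s < m \<Longrightarrow> r s \<le> r (Suc s)"
  shows "(\<Sum>s<m. \<Sum>s'<m. r (min s s') * y s * y s') \<ge> r 0 * (\<Sum>s<m. y s)\<^sup>2"
  using assms
proof (induction m arbitrary: r y)
  case (Suc m)
  define Y where "Y = (\<Sum>s<m. y (Suc s))"
  define Q where "Q = (\<Sum>s<m. \<Sum>s'<m. r (Suc (min s s')) * y (Suc s) * y (Suc s'))"
  have IH: "Q \<ge> r 1 * Y\<^sup>2"
    using Suc.IH[of "\<lambda>s. r (Suc s)" "\<lambda>s. y (Suc s)"] Suc.prems by (simp add: Q_def Y_def)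
  have "r 0 * Y\<^sup>2 \<le> r 1 * Y\<^sup>2"
    using Suc.prems[of 0] by (cases m) (auto simp: Y_def intro!: mult_right_mono)
  with IH have "Q \<ge> r 0 * Y\<^sup>2" by simp
  moreover have "(\<Sum>s<Suc m. \<Sum>s'<Suc m. r (min s s') * y s * y s')
      = r 0 * (y 0)\<^sup>2 + 2 * r 0 * y 0 * Y + Q"
    by (simp add: sum.lessThan_Suc_shift Q_def Y_def sum.distrib sum_distrib_left
        sum_distrib_right power2_eq_square algebra_simps del: sum.lessThan_Suc)
  moreover have "(\<Sum>s<Suc m. y s) = y 0 + Y"
    by (simp add: sum.lessThan_Suc_shift Y_def del: sum.lessThan_Suc)
  ultimately show ?case by (simp add: power2_eq_square algebra_simps)
qed auto

text \<open>As \<open>v (min s s') * v (max s s') = v s * v s'\<close>, the kernel is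
  \<open>r (min s s')\<close> with \<open>r = u / v\<close>, rescaled by \<open>v s * v s'\<close>;
  the hypothesis \<open>uv\<close> makes \<open>r\<close> nondecreasing.\<close>

lemma green_kernel_nonneg:
  fixes u v z :: "nat \<Rightarrow> real"
  assumes v: "\<And>s. s < m \<Longrightarrow> v s > 0" and u: "\<And>s. s < m \<Longrightarrow> u s \<ge> 0"
    and uv: "\<And>s. Suc s < m \<Longrightarrow> u s * v (Suc s) \<le> u (Suc s) * v s"
  shows "(\<Sum>s<m. \<Sum>s'<m. u (min s s') * v (max s s') * z s * z s') \<ge> 0"
proof (cases "m = 0")
  case False
  define r where "r s = u s / v s" for s
  have "r s \<le> r (Suc s)" if "Suc s < m" for s
    using v[of s] v[of "Suc s"] uv[of s] that by (simp add: r_def field_simps)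
  then have "r 0 * (\<Sum>s<m. v s * z s)\<^sup>2
      \<le> (\<Sum>s<m. \<Sum>s'<m. r (min s s') * (v s * z s) * (v s' * z s'))"
    by (rule min_kernel_ge)
  moreover have "0 \<le> r 0 * (\<Sum>s<m. v s * z s)\<^sup>2"
    using False u[of 0] v[of 0] by (simp add: r_def)
  moreover have "(\<Sum>s<m. \<Sum>s'<m. r (min s s') * (v s * z s) * (v s' * z s'))
     = (\<Sum>s<m. \<Sum>s'<m. u (min s s') * v (max s s') * z s * z s')"
  proof (intro sum.cong refl)
    fix s s' assume "s \<in> {..<m}" "s' \<in> {..<m}"
    then show "r (min s s') * (v s * z s) * (v s' * z s') = u (min s s') * v (max s s') * z s * z s'"
      using v[of s] v[of s'] by (cases "s \<le> s'") (auto simp: r_def min_def max_def field_simps)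
  qed
  ultimately show ?thesis by simp
qed auto

section \<open>Counting supersets and alternating binomial sums\<close>

lemma card_supersets:
  assumes "finite U" "S \<subseteq> U" "card S \<le> k"
  shows "card {B. S \<subseteq> B \<and> B \<subseteq> U \<and> card B = k} = (card U - card S) choose (k - card S)"
proof -
  have S: "finite S" using assms finite_subset by blast
  have "bij_betw (\<lambda>B. B - S) {B. S \<subseteq> B \<and> B \<subseteq> U \<and> card B = k} {C. C \<subseteq> U - S \<and> card C = k - card S}"
  proof (rule bij_betwI[where g = "\<lambda>C. C \<union> S"], goal_cases)
    case 1
    then show ?case using S by (auto simp: card_Diff_subset)
  next
    case 2
    have "card (C \<union> S) = k" if "C \<subseteq> U - S" "card C = k - card S" for C
    proof -
      have "finite C" using that assms finite_subset by blast
      then show ?thesis using that S assms by (subst card_Un_disjoint) auto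
    qed
    then show ?case using assms by auto
  qed auto
  then have "card {B. S \<subseteq> B \<and> B \<subseteq> U \<and> card B = k} = card {C. C \<subseteq> U - S \<and> card C = k - card S}"
    by (rule bij_betw_same_card)
  also have "\<dots> = card (U - S) choose (k - card S)"
    using assms by (intro n_subsets) auto
  finally show ?thesis using S assms by (simp add: card_Diff_subset)
qed

text \<open>Inclusion-exclusion for the \<open>(k - i)\<close>-subsets of a \<open>k\<close>-set
  that avoid a subset \<open>W\<close>: those containing \<open>R\<close> number
  \<open>(k - card R) choose i\<close>. It later expands a disjointness count into indicators of
  sets.\<close>

lemma choose_inclusion_exclusion:
  assumes "finite W" "card W \<le> k" "i \<le> k"
  shows "real ((k - card W) choose (k - i))
    = (\<Sum>R\<in>Pow W. (-1) ^ card R * real ((k - card R) choose i))"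
  using assms
proof (induction W arbitrary: k i rule: finite_induct)
  case empty
  then show ?case by (simp add: binomial_symmetric[symmetric])
next
  case (insert x W)
  then obtain k' where k': "k = Suc k'" "card W \<le> k'" by (cases k) auto
  have fin: "finite R" if "R \<in> Pow W" for R
    using that insert.hyps finite_subset by auto
  have "(\<Sum>R\<in>Pow (insert x W). (-1) ^ card R * real ((k - card R) choose i))
      = (\<Sum>R\<in>Pow W. (-1) ^ card R * real ((k - card R) choose i))
      + (\<Sum>R\<in>insert x ` Pow W. (-1) ^ card R * real ((k - card R) choose i))"
    unfolding Pow_insert using insert.hyps by (subst sum.union_disjoint) auto
  also have "(\<Sum>R\<in>insert x ` Pow W. (-1) ^ card R * real ((k - card R) choose i))
      = (\<Sum>R\<in>Pow W. (-1) ^ card (insert x R) * real ((k - card (insert x R)) choose i))"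
    using insert.hyps by (subst sum.reindex) (auto simp: inj_on_def)
  \<comment> \<open>The subsets containing \<open>x\<close> repeat the other terms with
    \<open>k'\<close> for \<open>k\<close> and the opposite sign, so Pascal's rule can merge the two
    halves.\<close>
  also have "\<dots> = (\<Sum>R\<in>Pow W. - ((-1) ^ card R * real ((k' - card R) choose i)))"
  proof (intro sum.cong refl)
    fix R assume R: "R \<in> Pow W"
    then have "card (insert x R) = Suc (card R)" using fin insert.hyps by (auto simp: card_insert_if)
    then show "(-1) ^ card (insert x R) * real ((k - card (insert x R)) choose i)
        = - ((-1) ^ card R * real ((k' - card R) choose i))" using k' by simp
  qed
  finally have *: "(\<Sum>R\<in>Pow (insert x W). (-1) ^ card R * real ((k - card R) choose i))
      = (\<Sum>R\<in>Pow W. (-1) ^ card R * (real ((k - card R) choose i) - real ((k' - card R) choose i)))"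
    by (simp add: sum_subtractf sum_negf right_diff_distrib)
  have le: "card R \<le> k'" if "R \<in> Pow W" for R
    using that insert.hyps k' card_mono[of W R] by auto
  show ?case
  proof (cases i)
    case 0
    with * k' insert.hyps show ?thesis by (simp add: le)
  next
    case (Suc i')
    have "(\<Sum>R\<in>Pow W. (-1) ^ card R * (real ((k - card R) choose i) - real ((k' - card R) choose i)))
       = (\<Sum>R\<in>Pow W. (-1) ^ card R * real ((k' - card R) choose i'))"
      using le k' Suc by (intro sum.cong) (auto simp: Suc_diff_le)
    also have "\<dots> = real ((k' - card W) choose (k' - i'))"
      using insert.IH[of k' i'] k' Suc insert.prems by simp
    finally show ?thesis using * k' Suc insert.hyps by simp
  qed
qed

text \<open>Passing from \<open>u = v\<close> to \<open>u = Suc v\<close> changes the sum, by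
  Pascal's rule, by a multiple of an alternating row sum, which is 0 unless \<open>v = r\<close>.
  This is the identity behind Wilson's coefficients.\<close>

lemma alternating_choose_shift:
  assumes "r < u"
  shows "(\<Sum>j=Suc r..u. (-1) ^ (j - Suc r) * real ((j - 1) choose r) * real (u choose j)) = 1"
proof -
  define g where "g u m = (\<Sum>j=Suc r..m. (-1) ^ (j - Suc r) * real ((j - 1) choose r) * real (u choose j))"
    for u m :: nat
  have g_ext: "g u m = g u u" if "u \<le> m" for u m
    unfolding g_def using that by (intro sum.mono_neutral_right) auto
  have step: "g (Suc v) (Suc v) - g v v = (if v = r then 1 else 0)" if "r \<le> v" for v
  proof -
    have "g (Suc v) (Suc v) - g v v = g (Suc v) (Suc v) - g v (Suc v)"
      using g_ext[of v "Suc v"] by simp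
    also have "\<dots> = (\<Sum>j=Suc r..Suc v. (-1) ^ (j - Suc r) * real ((j - 1) choose r) * real (v choose (j - 1)))"
      unfolding g_def sum_subtractf[symmetric]
    proof (intro sum.cong refl)
      fix j assume "j \<in> {Suc r..Suc v}"
      then obtain i where "j = Suc i" by (cases j) auto
      then show "(-1) ^ (j - Suc r) * real ((j - 1) choose r) * real (Suc v choose j)
          - (-1) ^ (j - Suc r) * real ((j - 1) choose r) * real (v choose j)
        = (-1) ^ (j - Suc r) * real ((j - 1) choose r) * real (v choose (j - 1))"
        by (simp add: algebra_simps)
    qed
    also have "\<dots> = (\<Sum>j=r..v. (-1) ^ (j - r) * real (j choose r) * real (v choose j))"
      by (subst sum.shift_bounds_cl_Suc_ivl) simp
    also have "\<dots> = (\<Sum>j=0+r..(v-r)+r. (-1) ^ (j - r) * real (j choose r) * real (v choose j))"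
      using that by simp
    also have "\<dots> = (\<Sum>j=0..v-r. (-1) ^ j * real ((j + r) choose r) * real (v choose (j + r)))"
      by (subst sum.shift_bounds_cl_nat_ivl) simp
    also have "\<dots> = (\<Sum>j=0..v-r. real (v choose r) * ((-1) ^ j * real ((v - r) choose j)))"
    proof (intro sum.cong refl)
      fix j assume "j \<in> {0..v-r}"
      then have "(v choose (j + r)) * ((j + r) choose r) = (v choose r) * ((v - r) choose j)"
        using choose_mult[of r "j + r" v] that by auto
      then have "real (v choose (j + r)) * real ((j + r) choose r) = real (v choose r) * real ((v - r) choose j)"
        unfolding of_nat_mult[symmetric] by simp
      then show "(-1) ^ j * real ((j + r) choose r) * real (v choose (j + r))
          = real (v choose r) * ((-1) ^ j * real ((v - r) choose j))" by (simp add: algebra_simps)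
    qed
    also have "\<dots> = real (v choose r) * (\<Sum>j\<le>v-r. (-1) ^ j * real ((v - r) choose j))"
      by (simp add: sum_distrib_left atLeast0AtMost)
    also have "\<dots> = (if v = r then 1 else 0)"
      using choose_alternating_sum[of "v - r", where 'a = real] that by auto
    finally show ?thesis .
  qed
  have "g u u = 1" using assms
  proof (induction u)
    case (Suc v)
    show ?case
    proof (cases "r = v")
      case True
      then show ?thesis by (simp add: g_def)
    next
      case False
      then show ?thesis using Suc step[of v] by simp
    qed
  qed auto
  then show ?thesis by (simp add: g_def)
qed

section \<open>Eigenvalues of Wilson's matrix\<close>

text \<open>Built from rising factorials so that the difference of the values at \<open>x\<close>
  and \<open>x + 1\<close> is again a nonnegative combination of functions of this shape.\<close>

definition poch_ratio :: "real \<Rightarrow> real \<Rightarrow> nat \<Rightarrow> nat \<Rightarrow> real \<Rightarrow> real" where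
  "poch_ratio c b p q x = pochhammer (c - x) p / pochhammer (b + x) q"

text \<open>Discrete product rule: differencing the numerator removes one of its factors,
  differencing the reciprocal denominator adds one. At \<open>p = 0\<close> the truncated
  \<open>p - 1\<close> is multiplied by 0.\<close>

lemma poch_ratio_diff:
  assumes "b + x > 0"
  shows "poch_ratio c b p q x - poch_ratio c b p q (x + 1)
    = real p * poch_ratio c (b + 1) (p - 1) q x + real q * poch_ratio c b p (q + 1) x"
proof -
  have pos: "pochhammer (b + x) q > 0" "pochhammer (b + x + 1) q > 0" "pochhammer (b + x) (Suc q) > 0"
    using assms by (auto intro!: pochhammer_pos)
  have num: "pochhammer (c - x) p - pochhammer (c - x - 1) p = real p * pochhammer (c - x) (p - 1)"
  proof (cases p)
    case (Suc p')
    then show ?thesis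
      using pochhammer_rec[of "c - x - 1" p'] pochhammer_rec'[of "c - x" p']
      by (simp add: algebra_simps)
  qed auto
  have den: "1 / pochhammer (b + x) q - 1 / pochhammer (b + x + 1) q
      = real q / pochhammer (b + x) (Suc q)"
  proof -
    have e1: "pochhammer (b + x) (Suc q) = (b + x) * pochhammer (b + x + 1) q"
      by (rule pochhammer_rec)
    have e2: "pochhammer (b + x) (Suc q) = (b + x + real q) * pochhammer (b + x) q"
      by (rule pochhammer_rec')
    have "1 / pochhammer (b + x) q = (b + x + real q) / pochhammer (b + x) (Suc q)"
      using pos assms by (simp add: e2 field_simps)
    moreover have "1 / pochhammer (b + x + 1) q = (b + x) / pochhammer (b + x) (Suc q)"
      using pos assms by (simp add: e1 field_simps)
    ultimately show ?thesis by (simp add: diff_divide_distrib[symmetric])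
  qed
  have "poch_ratio c b p q x - poch_ratio c b p q (x + 1)
     = (pochhammer (c - x) p - pochhammer (c - x - 1) p) / pochhammer (b + x + 1) q
      + pochhammer (c - x) p * (1 / pochhammer (b + x) q - 1 / pochhammer (b + x + 1) q)"
    by (simp add: poch_ratio_def diff_divide_distrib right_diff_distrib algebra_simps)
  also have "\<dots> = real p * pochhammer (c - x) (p - 1) / pochhammer (b + x + 1) q
      + pochhammer (c - x) p * (real q / pochhammer (b + x) (Suc q))"
    by (simp only: num den)
  finally show ?thesis by (simp add: poch_ratio_def add.commute add.left_commute)
qed

lemma alternating_sum_Suc:
  fixes f :: "nat \<Rightarrow> real"
  shows "(\<Sum>i\<le>Suc m. (-1) ^ i * real (Suc m choose i) * f i)
    = (\<Sum>i\<le>m. (-1) ^ i * real (m choose i) * (f i - f (Suc i)))"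
proof -
  have "(\<Sum>i\<le>Suc m. (-1) ^ i * real (Suc m choose i) * f i)
     = f 0 + (\<Sum>i\<le>m. (-1) ^ Suc i * real (Suc m choose Suc i) * f (Suc i))"
    by (subst sum.atMost_Suc_shift) simp
  also have "\<dots> = (f 0 + (\<Sum>i\<le>m. (-1) ^ Suc i * real (m choose Suc i) * f (Suc i)))
      - (\<Sum>i\<le>m. (-1) ^ i * real (m choose i) * f (Suc i))"
    by (simp add: algebra_simps sum.distrib sum_negf sum_subtractf)
  also have "f 0 + (\<Sum>i\<le>m. (-1) ^ Suc i * real (m choose Suc i) * f (Suc i))
      = (\<Sum>i\<le>Suc m. (-1) ^ i * real (m choose i) * f i)"
    by (simp add: sum.atMost_Suc_shift[of _ m] del: sum.atMost_Suc)
  also have "\<dots> = (\<Sum>i\<le>m. (-1) ^ i * real (m choose i) * f i)" by simp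
  finally show ?thesis by (simp add: sum_subtractf right_diff_distrib)
qed

text \<open>Each of the \<open>m\<close> differences either lowers the numerator, \<open>l\<close>
  times in all, or raises the denominator. For \<open>c > 0\<close> every summand on the right is
  nonnegative, so no cancellation is left.\<close>

lemma poch_ratio_iterated_diff:
  assumes "b > 0" "m \<le> p" "q \<ge> 1"
  shows "(\<Sum>i\<le>m. (-1) ^ i * real (m choose i) * poch_ratio c b p q (real i))
    = fact m * (\<Sum>l\<le>m. real (p choose l) * real ((q + m - l - 1) choose (m - l))
        * poch_ratio c (b + real l) (p - l) (q + m - l) 0)"
  using assms
proof (induction m arbitrary: b p q)
  case (Suc m)
  obtain p' where p': "p = Suc p'" using Suc.prems by (cases p) auto
  define H where "H l = poch_ratio c (b + real l) (p - l) (q + Suc m - l) 0" for l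
  define K where "K l = real (p choose l) * real ((q + Suc m - l - 1) choose (Suc m - l)) * H l" for l
  have "(\<Sum>i\<le>Suc m. (-1) ^ i * real (Suc m choose i) * poch_ratio c b p q (real i))
     = (\<Sum>i\<le>m. (-1) ^ i * real (m choose i) *
          (poch_ratio c b p q (real i) - poch_ratio c b p q (real i + 1)))"
    by (subst alternating_sum_Suc) (simp add: add.commute)
  also have "\<dots> = (\<Sum>i\<le>m. (-1) ^ i * real (m choose i) *
          (real p * poch_ratio c (b + 1) p' q (real i) + real q * poch_ratio c b p (q + 1) (real i)))"
    using Suc.prems by (intro sum.cong refl, subst poch_ratio_diff) (auto simp: p')
  also have "\<dots> = real p * (\<Sum>i\<le>m. (-1) ^ i * real (m choose i) * poch_ratio c (b + 1) p' q (real i))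
      + real q * (\<Sum>i\<le>m. (-1) ^ i * real (m choose i) * poch_ratio c b p (q + 1) (real i))"
    by (simp add: sum_distrib_left sum.distrib[symmetric] algebra_simps)
  also have "(\<Sum>i\<le>m. (-1) ^ i * real (m choose i) * poch_ratio c (b + 1) p' q (real i))
     = fact m * (\<Sum>l\<le>m. real (p' choose l) * real ((q + m - l - 1) choose (m - l)) * H (Suc l))"
    using Suc.prems
    by (subst Suc.IH) (auto simp: p' H_def algebra_simps intro!: sum.cong)
  also have "(\<Sum>i\<le>m. (-1) ^ i * real (m choose i) * poch_ratio c b p (q + 1) (real i))
     = fact m * (\<Sum>l\<le>m. real (p choose l) * real ((q + m - l) choose (m - l)) * H l)"
    using Suc.prems
    by (subst Suc.IH) (auto simp: H_def algebra_simps intro!: sum.cong)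
  also have "real p * (fact m * (\<Sum>l\<le>m. real (p' choose l) * real ((q + m - l - 1) choose (m - l)) * H (Suc l)))
     = fact m * (\<Sum>l\<le>m. real (Suc l) * K (Suc l))"
  proof -
    have "real p * real (p' choose l) = real (Suc l) * real (p choose Suc l)" for l
      using Suc_times_binomial_eq[of p' l] unfolding p' of_nat_mult[symmetric]
      by (simp only: of_nat_eq_iff mult.commute)
    then have "real p * (real (p' choose l) * real ((q + m - l - 1) choose (m - l)) * H (Suc l))
        = real (Suc l) * K (Suc l)" for l
      by (simp add: K_def mult.assoc[symmetric])
    then show ?thesis by (simp add: sum_distrib_left mult.left_commute)
  qed
  also have "(\<Sum>l\<le>m. real (Suc l) * K (Suc l)) = (\<Sum>l\<le>Suc m. real l * K l)"
    by (simp add: sum.atMost_Suc_shift[of _ m] del: sum.atMost_Suc)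
  also have "real q * (fact m * (\<Sum>l\<le>m. real (p choose l) * real ((q + m - l) choose (m - l)) * H l))
     = fact m * (\<Sum>l\<le>m. real (Suc m - l) * K l)"
  proof -
    have "real q * (real (p choose l) * real ((q + m - l) choose (m - l)) * H l) = real (Suc m - l) * K l"
      if "l \<le> m" for l
    proof -
      obtain j where j: "m = l + j" using \<open>l \<le> m\<close> le_Suc_ex by blast
      have "Suc j * ((q + j) choose Suc j) = q * ((q + j) choose j)"
      proof (cases q)
        case (Suc q')
        then show ?thesis
          using binomial_absorb_comp[of "Suc (q' + j)" j] Suc_times_binomial_eq[of "q' + j" j]
          by (simp add: mult.commute del: binomial_Suc_Suc)
      qed (use Suc.prems in auto)
      then have "real q * real ((q + j) choose j) = real (Suc j) * real ((q + j) choose Suc j)"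
        unfolding of_nat_mult[symmetric] by (simp only: of_nat_eq_iff)
      moreover have "real q * (x * real ((q + j) choose j) * h) = x * (real q * real ((q + j) choose j)) * h"
        for x h by simp
      ultimately have "real q * (real (p choose l) * real ((q + j) choose j) * H l)
          = real (p choose l) * (real (Suc j) * real ((q + j) choose Suc j)) * H l"
        by simp
      then show ?thesis by (simp add: K_def j Suc_diff_le)
    qed
    then show ?thesis by (simp add: sum_distrib_left mult.left_commute)
  qed
  also have "(\<Sum>l\<le>m. real (Suc m - l) * K l) = (\<Sum>l\<le>Suc m. real (Suc m - l) * K l)"
    by simp
  \<comment> \<open>The term \<open>K l\<close> comes with weight \<open>l\<close> from lowering the
    numerator and \<open>Suc m - l\<close> from raising the denominator; the total
    \<open>Suc m\<close> turns \<open>fact m\<close> into \<open>fact (Suc m)\<close>.\<close>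
  also have "fact m * (\<Sum>l\<le>Suc m. real l * K l) + fact m * (\<Sum>l\<le>Suc m. real (Suc m - l) * K l)
      = fact m * (\<Sum>l\<le>Suc m. (real l + real (Suc m - l)) * K l)"
    by (simp only: distrib_left[symmetric] sum.distrib[symmetric] distrib_right[symmetric])
  also have "(\<Sum>l\<le>Suc m. (real l + real (Suc m - l)) * K l) = (\<Sum>l\<le>Suc m. real (Suc m) * K l)"
    by (intro sum.cong refl) (auto simp: of_nat_diff)
  also have "fact m * \<dots> = fact (Suc m) * (\<Sum>l\<le>Suc m. K l)"
    by (simp only: sum_distrib_left[symmetric] fact_Suc of_nat_mult) (simp only: mult_ac of_nat_fact)
  finally show ?case unfolding K_def H_def .
qed auto

text \<open>Comparison with a geometric series through \<open>2 ^ (m - 1) <= m!\<close>. The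
  correction \<open>4 / 2 ^ m\<close> gives equality at \<open>m = 1\<close> and lets the induction
  close.\<close>

lemma sum_inverse_fact_le: "(\<Sum>r<m. 1 / fact r) \<le> (3 - 4 / 2 ^ m :: real)" if "m \<ge> 1"
  using that
proof (induction m rule: nat_induct_at_least)
  case (Suc m)
  have "(2::nat) ^ (m - 1) \<le> fact m"
  proof -
    have "2 ^ j \<le> (fact (Suc j) :: nat)" for j
    proof (induction j)
      case (Suc j)
      have "2 * 2 ^ j \<le> Suc (Suc j) * (fact (Suc j) :: nat)" by (intro mult_mono Suc) auto
      then show ?case by simp
    qed auto
    from this[of "m - 1"] show ?thesis using Suc.hyps by simp
  qed
  then have "(2::real) ^ (m - 1) \<le> fact m"
    by (metis of_nat_le_iff of_nat_power of_nat_numeral of_nat_fact)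
  then have "1 / fact m \<le> (1 / 2 ^ (m - 1) :: real)"
    by (intro divide_left_mono) auto
  also have "\<dots> = 2 / 2 ^ m" using Suc.hyps by (cases m) auto
  finally show ?case using Suc.IH by simp
qed auto

lemma sum_pred_div_fact: "(\<Sum>r<m. real (Suc r) / fact (r + 2)) = 1 - 1 / (fact (Suc m) :: real)"
proof (induction m)
  case (Suc m)
  have "real (Suc m) / fact (m + 2) = 1 / fact (Suc m) - 1 / fact (m + 2)"
    by (simp add: divide_simps)
  then show ?case using Suc by simp
qed auto

section \<open>Wilson's coefficients and the closed form of the eigenvalues\<close>

text \<open>The denominator cancels the count in \<open>B_ind\<close>; sign and numerator are the
  coefficient in \<open>alternating_choose_shift\<close> for \<open>r = k - t\<close> and
  \<open>j = k - i\<close>.\<close>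

definition wilson_coeff :: "nat \<Rightarrow> nat \<Rightarrow> nat \<Rightarrow> nat \<Rightarrow> real" where
  "wilson_coeff n k t i = (-1) ^ (t - 1 - i) * real ((k - 1 - i) choose (k - t))
     / real ((n - k - t + i) choose (k - t))"

text \<open>The eigenvalue of the operator \<open>B i\<close> below on the \<open>e\<close>-th
  eigenspace of the Johnson scheme.\<close>

definition johnson_eigenvalue :: "nat \<Rightarrow> nat \<Rightarrow> nat \<Rightarrow> nat \<Rightarrow> real" where
  "johnson_eigenvalue n k i e = (-1) ^ e * real ((k - e) choose i) * real ((n - k + i - e) choose (k - e))"

definition wilson_eigenvalue :: "nat \<Rightarrow> nat \<Rightarrow> nat \<Rightarrow> nat \<Rightarrow> real" where
  "wilson_eigenvalue n k t e = 1 + (\<Sum>i<t. wilson_coeff n k t i * johnson_eigenvalue n k i e)"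

text \<open>The absolute value of the eigenvalue of \<open>P\<^sub>t - I\<close> on the \<open>e\<close>-th eigenspace for \<open>t < e\<close>, written
  without cancellation.\<close>
definition wilson_tail :: "nat \<Rightarrow> nat \<Rightarrow> nat \<Rightarrow> nat \<Rightarrow> real" where
  "wilson_tail n k t e = (\<Sum>l<t. real ((e - 1) choose l) * real ((e - 2 - l) choose (t - 1 - l))
     * (pochhammer (real (k - e) + 1) (e - 1 - l) / pochhammer (real (n - k - e + l) + 1) (e - 1 - l)))"

lemma pochhammer_real_fact: "pochhammer (real a + 1) m = fact (a + m) / fact a"
  by (induction m) (auto simp: pochhammer_Suc algebra_simps)

text \<open>Written in factorials, the \<open>i\<close>-th summand is a term of a
  \<open>(t - 1)\<close>-th difference of one rational function, ready for
  \<open>poch_ratio_iterated_diff\<close>.\<close>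

lemma wilson_coeff_eigenvalue:
  assumes "i < t" "t < e" "e \<le> k" "2 * k \<le> n"
  shows "wilson_coeff n k t i * johnson_eigenvalue n k i e
    = (-1) ^ (e - t - 1) / fact (t - 1) * ((-1) ^ i * real ((t - 1) choose i)
        * poch_ratio (real (k - e) + 1) (real (n - k - e) + 1) (e - 1) (e - t) (real i))"
proof -
  \<comment> \<open>The even exponent \<open>2 * i\<close> keeps the sign and replaces the truncated
    \<open>- i\<close> by \<open>+ i\<close>.\<close>
  have "(-1) ^ (t - 1 - i) * (-1) ^ e = (-1) ^ (t - 1 - i + e) * ((-1) ^ (2 * i) :: real)"
    by (simp add: power_add)
  also have "\<dots> = (-1) ^ (t - 1 - i + e + 2 * i)"
    by (simp add: power_add)
  also have "t - 1 - i + e + 2 * i = (e - t - 1) + i + 2 * t" using assms by simp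
  also have "(-1::real) ^ ((e - t - 1) + i + 2 * t) = (-1) ^ (e - t - 1) * (-1) ^ i"
    by (simp add: power_add)
  finally have sign: "(-1) ^ (t - 1 - i) * (-1) ^ e = (-1) ^ (e - t - 1) * ((-1) ^ i :: real)" .
  have "real ((k - 1 - i) choose (k - t)) * real ((k - e) choose i) * real ((n - k + i - e) choose (k - e))
       / real ((n - k - t + i) choose (k - t))
     = real ((t - 1) choose i) / fact (t - 1)
       * poch_ratio (real (k - e) + 1) (real (n - k - e) + 1) (e - 1) (e - t) (real i)"
  proof (cases "i \<le> k - e")
    case True
    obtain r where r: "k = e + (i + r)" using True assms(3) le_Suc_ex by (metis add_diff_inverse_nat le_add_diff_inverse)
    obtain d where d: "e = t + d" using assms(2) by (metis less_imp_add_positive)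
    obtain h where h: "t = Suc (i + h)" using assms(1) less_iff_Suc_add by auto
    obtain m where m: "n = 2 * k + m" using assms(4) le_Suc_ex by blast
    have p1: "pochhammer (real (k - e) + 1 - real i) (e - 1) = fact (r + (e - 1)) / fact r"
      using pochhammer_real_fact[of r "e - 1"] by (simp add: r algebra_simps)
    have p2: "pochhammer (real (n - k - e) + 1 + real i) (e - t)
        = fact (n - k - e + i + d) / fact (n - k - e + i)"
      using pochhammer_real_fact[of "n - k - e + i" d] by (simp add: d algebra_simps)
    have b1: "real ((k - 1 - i) choose (k - t)) = fact (r + (e - 1)) / (fact (k - t) * fact h)"
      by (subst binomial_fact) (auto simp: r d h add_ac)
    have b2: "real ((k - e) choose i) = fact (k - e) / (fact i * fact r)"
      by (subst binomial_fact) (auto simp: r)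
    have b3: "real ((n - k + i - e) choose (k - e)) = fact (n - k - e + i) / (fact (k - e) * fact (m + i))"
      by (subst binomial_fact) (auto simp: m r add_ac)
    have b4: "real ((n - k - t + i) choose (k - t)) = fact (n - k - e + i + d) / (fact (k - t) * fact (m + i))"
      by (subst binomial_fact) (auto simp: m r d add_ac)
    have b5: "real ((t - 1) choose i) = fact (t - 1) / (fact i * fact h)"
      by (subst binomial_fact) (auto simp: h)
    show ?thesis unfolding poch_ratio_def p1 p2 b1 b2 b3 b4 b5 by simp
  next
    case False
    \<comment> \<open>Here \<open>i > k - e\<close>, so a binomial on the left is 0. The numerator
      on the right starts at an integer \<open><= 0\<close> and has enough factors to pass through
      0.\<close>
    have "real (k - e) + 1 - real i = - real (i - (k - e) - 1)" using False by (simp add: of_nat_diff)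
    moreover have "i - (k - e) - 1 < e - 1" using False assms by linarith
    ultimately have "pochhammer (real (k - e) + 1 - real i) (e - 1) = 0"
      unfolding pochhammer_eq_0_iff by blast
    with False show ?thesis by (simp add: poch_ratio_def)
  qed
  note coeffs = this
  have "wilson_coeff n k t i * johnson_eigenvalue n k i e = ((-1) ^ (t - 1 - i) * (-1) ^ e)
      * (real ((k - 1 - i) choose (k - t)) * real ((k - e) choose i) * real ((n - k + i - e) choose (k - e))
       / real ((n - k - t + i) choose (k - t)))"
    by (simp add: wilson_coeff_def johnson_eigenvalue_def)
  then show ?thesis unfolding sign coeffs by simp
qed

text \<open>The sum is a \<open>(t - 1)\<close>-th difference with \<open>p = e - 1\<close> and
  \<open>q = e - t\<close>. Its sign depends only on the parity of the gap
  \<open>e - t\<close>.\<close>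

lemma wilson_eigenvalue_eq:
  assumes "1 \<le> t" "t < e" "e \<le> k" "2 * k \<le> n"
  shows "wilson_eigenvalue n k t e = 1 + (-1) ^ (e - t - 1) * wilson_tail n k t e"
proof -
  obtain m where m: "t = Suc m" using assms by (cases t) auto
  let ?P = "poch_ratio (real (k - e) + 1) (real (n - k - e) + 1)"
  have "(\<Sum>i<t. wilson_coeff n k t i * johnson_eigenvalue n k i e)
     = (\<Sum>i<t. (-1) ^ (e - t - 1) / fact m * ((-1) ^ i * real (m choose i) * ?P (e - 1) (e - t) (real i)))"
    using assms by (intro sum.cong refl, subst wilson_coeff_eigenvalue) (auto simp: m)
  also have "\<dots> = (-1) ^ (e - t - 1) / fact m
      * (\<Sum>i\<le>m. (-1) ^ i * real (m choose i) * ?P (e - 1) (e - t) (real i))"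
    by (simp add: sum_distrib_left m lessThan_Suc_atMost)
  also have "\<dots> = (-1) ^ (e - t - 1) * (\<Sum>l\<le>m. real ((e - 1) choose l)
      * real ((e - t + m - l - 1) choose (m - l))
        * poch_ratio (real (k - e) + 1) (real (n - k - e) + 1 + real l) (e - 1 - l) (e - t + m - l) 0)"
    using assms by (subst poch_ratio_iterated_diff) (auto simp: m)
  also have "(\<Sum>l\<le>m. real ((e - 1) choose l) * real ((e - t + m - l - 1) choose (m - l))
        * poch_ratio (real (k - e) + 1) (real (n - k - e) + 1 + real l) (e - 1 - l) (e - t + m - l) 0)
      = wilson_tail n k t e"
    unfolding wilson_tail_def
  proof (intro sum.cong)
    fix l assume "l \<in> {..<t}"
    then have "e - t + m - l - 1 = e - 2 - l" "m - l = t - 1 - l" "e - t + m - l = e - 1 - l"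
      using assms m by auto
    then show "real ((e - 1) choose l) * real ((e - t + m - l - 1) choose (m - l))
        * poch_ratio (real (k - e) + 1) (real (n - k - e) + 1 + real l) (e - 1 - l) (e - t + m - l) 0
       = real ((e - 1) choose l) * real ((e - 2 - l) choose (t - 1 - l))
     * (pochhammer (real (k - e) + 1) (e - 1 - l) / pochhammer (real (n - k - e + l) + 1) (e - 1 - l))"
      by (simp add: poch_ratio_def add_ac)
  qed (auto simp: m)
  finally show ?thesis by (simp add: wilson_eigenvalue_def)
qed

lemma wilson_tail_nonneg: "0 \<le> wilson_tail n k t e"
  unfolding wilson_tail_def
  by (intro sum_nonneg mult_nonneg_nonneg divide_nonneg_nonneg pochhammer_nonneg) auto

text \<open>The numerator factors pair \<open>e - j\<close> with \<open>k - e + j\<close>, whose product is at most \<open>k\<^sup>2 / 4\<close>.\<close>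
lemma wilson_tail_term_le:
  assumes "l < e" "e \<le> k" "2 * k < n"
  shows "real ((e - 1) choose l) * (pochhammer (real (k - e) + 1) (e - 1 - l)
      / pochhammer (real (n - k - e + l) + 1) (e - 1 - l))
    \<le> (real k ^ 2 / (4 * (real n - 2 * real k))) ^ (e - 1 - l) / fact (e - 1 - l)"
proof -
  define q where "q = e - 1 - l"
  have e: "e = Suc (l + q)" using assms by (simp add: q_def)
  define y where "y = real k ^ 2 / (4 * (real n - 2 * real k))"
  have "real ((e - 1) choose l) = fact (l + q) / (fact l * fact q)"
    by (subst binomial_fact) (auto simp: e)
  also have "\<dots> = pochhammer (real l + 1) q / fact q"
    by (simp add: pochhammer_real_fact)
  finally have b: "real ((e - 1) choose l) = pochhammer (real l + 1) q / fact q" .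
  \<comment> \<open>Reversing one product pairs \<open>l + 1 + j\<close> with
    \<open>k - e + q - j\<close>; these sum to \<open>k\<close>.\<close>
  have r: "pochhammer (real (k - e) + 1) q = (\<Prod>j<q. real (k - e) + 1 + real (q - Suc j))"
    unfolding pochhammer_prod atLeast0LessThan by (rule prod.nat_diff_reindex[symmetric])
  have "pochhammer (real l + 1) q * pochhammer (real (k - e) + 1) q / pochhammer (real (n - k - e + l) + 1) q
     = (\<Prod>j<q. (real l + 1 + real j) * (real (k - e) + 1 + real (q - Suc j))
          / (real (n - k - e + l) + 1 + real j))"
    unfolding r by (simp add: pochhammer_prod atLeast0LessThan prod.distrib prod_dividef)
  also have "\<dots> \<le> (\<Prod>j<q. y)"
  proof (intro prod_mono conjI)
    fix j assume j: "j \<in> {..<q}"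
    let ?a = "real l + 1 + real j" and ?b = "real (k - e) + 1 + real (q - Suc j)"
    have sum: "?a + ?b = real k" using j assms e by (simp add: of_nat_diff)
    have "0 \<le> (?a - ?b) ^ 2" by simp
    then have "4 * (?a * ?b) \<le> (?a + ?b) ^ 2" by (simp only: power2_sum power2_diff)
    then have "?a * ?b \<le> real k ^ 2 / 4" by (simp only: sum)
    moreover have "real (n - k - e + l) + 1 + real j \<ge> real n - 2 * real k"
      using assms by (simp add: of_nat_diff)
    ultimately have "?a * ?b / (real (n - k - e + l) + 1 + real j)
        \<le> (real k ^ 2 / 4) / (real n - 2 * real k)"
      using assms by (intro frac_le) auto
    then show "?a * ?b / (real (n - k - e + l) + 1 + real j) \<le> y" by (simp add: y_def)
  qed auto
  also have "\<dots> = y ^ q" by simp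
  finally have "pochhammer (real l + 1) q * pochhammer (real (k - e) + 1) q
      / pochhammer (real (n - k - e + l) + 1) q / fact q \<le> y ^ q / fact q"
    by (intro divide_right_mono) auto
  then show ?thesis unfolding b unfolding q_def[symmetric] y_def[symmetric] by (simp add: mult_ac)
qed

text \<open>Termwise estimate; the substitution \<open>l = t - 1 - r\<close> then exposes the gap
  \<open>e - t\<close>, which governs all later bounds.\<close>

lemma wilson_tail_le:
  assumes "t < e" "e \<le> k" "2 * k < n"
  defines "y \<equiv> real k ^ 2 / (4 * (real n - 2 * real k))"
  shows "wilson_tail n k t e \<le> (\<Sum>r<t. real ((e - t + r - 1) choose r) * y ^ (e - t + r) / fact (e - t + r))"
proof -
  have "wilson_tail n k t e
      \<le> (\<Sum>l<t. real ((e - 2 - l) choose (t - 1 - l)) * (y ^ (e - 1 - l) / fact (e - 1 - l)))"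
    unfolding wilson_tail_def
  proof (rule sum_mono)
    fix l assume "l \<in> {..<t}"
    then have "real ((e - 2 - l) choose (t - 1 - l)) * (real ((e - 1) choose l) *
        (pochhammer (real (k - e) + 1) (e - 1 - l) / pochhammer (real (n - k - e + l) + 1) (e - 1 - l)))
      \<le> real ((e - 2 - l) choose (t - 1 - l)) * (y ^ (e - 1 - l) / fact (e - 1 - l))"
      using assms unfolding y_def by (intro mult_left_mono wilson_tail_term_le) auto
    then show "real ((e - 1) choose l) * real ((e - 2 - l) choose (t - 1 - l)) *
        (pochhammer (real (k - e) + 1) (e - 1 - l) / pochhammer (real (n - k - e + l) + 1) (e - 1 - l))
      \<le> real ((e - 2 - l) choose (t - 1 - l)) * (y ^ (e - 1 - l) / fact (e - 1 - l))"
      by (simp only: mult_ac)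
  qed
  also have "\<dots> = (\<Sum>r<t. real ((e - 2 - (t - Suc r)) choose (t - 1 - (t - Suc r)))
      * (y ^ (e - 1 - (t - Suc r)) / fact (e - 1 - (t - Suc r))))"
    by (rule sum.nat_diff_reindex[symmetric])
  also have "\<dots> = (\<Sum>r<t. real ((e - t + r - 1) choose r) * y ^ (e - t + r) / fact (e - t + r))"
  proof (intro sum.cong refl)
    fix r assume "r \<in> {..<t}"
    then have "e - 2 - (t - Suc r) = e - t + r - 1" "t - 1 - (t - Suc r) = r" "e - 1 - (t - Suc r) = e - t + r"
      using assms by auto
    then show "real ((e - 2 - (t - Suc r)) choose (t - 1 - (t - Suc r)))
      * (y ^ (e - 1 - (t - Suc r)) / fact (e - 1 - (t - Suc r)))
      = real ((e - t + r - 1) choose r) * y ^ (e - t + r) / fact (e - t + r)" by simp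
  qed
  finally show ?thesis .
qed

section \<open>Numerical bounds on the tail by the gap \<open>e - t\<close>\<close>

context
  fixes n k t e :: nat and y :: real
  assumes tek: "t < e" "e \<le> k" "2 * k < n"
    and y_def: "y = real k ^ 2 / (4 * (real n - 2 * real k))" and y1: "y \<le> 1"
begin

lemma ratio_nonneg: "0 \<le> y"
  using tek by (simp add: y_def)

text \<open>With \<open>d = e - t\<close>, \<open>((d + r - 1) choose r) / (d + r)!\<close> equals
  \<open>1 / ((d + r) (d - 1)! r!)\<close>, which is at most \<open>1 / (d! r!)\<close>; the sum of
  \<open>1 / r!\<close> stays below 3.\<close>

lemma wilson_tail_le_fact: "wilson_tail n k t e \<le> 3 / fact (e - t)"
proof -
  define d where "d = e - t"
  have d: "d \<ge> 1" using tek by (simp add: d_def)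
  have "wilson_tail n k t e \<le> (\<Sum>r<t. real ((d + r - 1) choose r) * y ^ (d + r) / fact (d + r))"
    using wilson_tail_le[OF tek] by (simp add: d_def y_def)
  also have "\<dots> \<le> (\<Sum>r<t. 1 / fact d * (1 / fact r))"
  proof (rule sum_mono)
    fix r
    obtain d' where d': "d = Suc d'" using d by (cases d) auto
    have "real ((d + r - 1) choose r) = fact (d' + r) / (fact r * fact d')"
      by (subst binomial_fact) (auto simp: d')
    then have "real ((d + r - 1) choose r) / fact (d + r) = 1 / (real (d + r) * fact d' * fact r)"
      by (simp add: d')
    also have "\<dots> \<le> 1 / (real d * fact d' * fact r)"
      using d by (intro divide_left_mono mult_right_mono mult_pos_pos) auto
    also have "\<dots> = 1 / fact d * (1 / fact r)" by (simp add: d')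
    finally have "real ((d + r - 1) choose r) / fact (d + r) \<le> 1 / fact d * (1 / fact r)" .
    moreover have "real ((d + r - 1) choose r) / fact (d + r) * y ^ (d + r)
        \<le> real ((d + r - 1) choose r) / fact (d + r) * 1"
      using ratio_nonneg y1 by (intro mult_left_mono power_le_one) auto
    ultimately show "real ((d + r - 1) choose r) * y ^ (d + r) / fact (d + r) \<le> 1 / fact d * (1 / fact r)"
      by simp
  qed
  also have "\<dots> = 1 / fact d * (\<Sum>r<t. 1 / fact r)" by (simp add: sum_distrib_left)
  also have "\<dots> \<le> 1 / fact d * 3"
  proof (intro mult_left_mono)
    show "(\<Sum>r<t. 1 / fact r) \<le> (3 :: real)"
      using sum_inverse_fact_le[of t] by (cases t) (auto intro: order_trans)
  qed auto
  finally show ?thesis by (simp add: d_def)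
qed

text \<open>At gap 1 the exponential series without its first term dominates, giving
  \<open>3 - 1\<close>; for larger gaps \<open>3 / 2!\<close> suffices.\<close>

lemma wilson_tail_le_2: "wilson_tail n k t e \<le> 2"
proof (cases "e - t = 1")
  case True
  have "wilson_tail n k t e \<le> (\<Sum>r<t. y ^ (1 + r) / fact (1 + r))"
    using wilson_tail_le[OF tek] unfolding True y_def by simp
  also have "\<dots> \<le> (\<Sum>r<t. 1 / fact (Suc r))"
    using ratio_nonneg y1 by (intro sum_mono) (auto intro!: divide_right_mono mult_le_one power_le_one)
  also have "\<dots> = (\<Sum>r<Suc t. 1 / fact r) - 1"
    by (simp add: sum.lessThan_Suc_shift del: sum.lessThan_Suc)
  also have "\<dots> \<le> 2" using sum_inverse_fact_le[of "Suc t"] by (auto intro: order_trans)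
  finally show ?thesis .
next
  case False
  then have "(fact 2 :: real) \<le> fact (e - t)" using tek by (intro fact_mono) auto
  then have "3 / fact (e - t) \<le> (3 / fact 2 :: real)" by (intro divide_left_mono) auto
  also have "\<dots> \<le> 2" by (simp add: fact_numeral)
  finally show ?thesis using wilson_tail_le_fact by linarith
qed

lemma wilson_tail_le_eighth:
  assumes "e - t \<ge> 4"
  shows "wilson_tail n k t e \<le> 1 / 8"
proof -
  have "(fact 4 :: real) \<le> fact (e - t)" using assms by (intro fact_mono) auto
  then have "3 / fact (e - t) \<le> (3 / fact 4 :: real)" by (intro divide_left_mono) auto
  also have "\<dots> = 1 / 8" by (simp add: fact_numeral)
  finally show ?thesis using wilson_tail_le_fact by linarith
qed

text \<open>At gap 2 the tail is subtracted from 1 and the bound \<open>3 / 2!\<close> is too weak.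
  Keeping one factor \<open>y\<close> leaves a telescoping sum below 1.\<close>

lemma wilson_tail_le_y:
  assumes "e - t = 2"
  shows "wilson_tail n k t e \<le> y"
proof -
  have "wilson_tail n k t e \<le> (\<Sum>r<t. real (Suc r) * y ^ (2 + r) / fact (2 + r))"
    using wilson_tail_le[OF tek] unfolding assms y_def by simp
  also have "\<dots> \<le> (\<Sum>r<t. y * (real (Suc r) / fact (r + 2)))"
  proof (rule sum_mono)
    fix r
    have "y ^ (1 + r) \<le> 1" using ratio_nonneg y1 by (intro power_le_one)
    then have le: "y * y ^ (1 + r) \<le> y * 1" using ratio_nonneg by (rule mult_left_mono)
    have "real (Suc r) * y ^ (2 + r) / fact (2 + r) = real (Suc r) / fact (r + 2) * (y * y ^ (1 + r))"
      by (simp add: add.commute power2_eq_square)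
    also have "\<dots> \<le> real (Suc r) / fact (r + 2) * (y * 1)"
      by (rule mult_left_mono[OF le]) simp
    finally show "real (Suc r) * y ^ (2 + r) / fact (2 + r) \<le> y * (real (Suc r) / fact (r + 2))"
      by (simp only: mult_ac mult_1_left)
  qed
  also have "\<dots> = y * (1 - 1 / fact (Suc t))"
    by (simp only: sum_distrib_left[symmetric] sum_pred_div_fact)
  also have "\<dots> \<le> y * 1" using ratio_nonneg by (intro mult_left_mono) auto
  finally show ?thesis by simp
qed

end

section \<open>The Johnson scheme\<close>

definition ind :: "'a set \<Rightarrow> 'a set \<Rightarrow> real" where
  "ind S A = of_bool (S \<subseteq> A)"

locale johnson =
  fixes n k :: nat
  assumes two_k_le: "2 * k \<le> n"
begin

definition K :: "nat set set" where "K = nsets {1..n} k"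

definition ip :: "(nat set \<Rightarrow> real) \<Rightarrow> (nat set \<Rightarrow> real) \<Rightarrow> real" where
  "ip f g = (\<Sum>A\<in>K. f A * g A)"

definition small :: "nat \<Rightarrow> nat set set" where
  "small e = {S. S \<subseteq> {1..n} \<and> card S < e}"

text \<open>The span of the indicators of sets with strictly fewer than \<open>e\<close> elements, so \<open>V 0\<close> is trivial
  and the \<open>e\<close>-th eigenspace is the orthogonal complement of \<open>V e\<close> in \<open>V (Suc e)\<close>. Functions only
  matter on \<open>K\<close>.\<close>
definition V :: "nat \<Rightarrow> (nat set \<Rightarrow> real) set" where
  "V e = {f. \<exists>c. \<forall>A\<in>K. f A = (\<Sum>S\<in>small e. c S * ind S A)}"

text \<open>The kernel of \<open>B i\<close> vanishes on pairs of sets meeting in more than \<open>i\<close> elements.\<close>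
definition B :: "nat \<Rightarrow> (nat set \<Rightarrow> real) \<Rightarrow> nat set \<Rightarrow> real" where
  "B i f A = (\<Sum>A'\<in>K. real (card (A - A') choose (k - i)) * f A')"

definition P :: "nat \<Rightarrow> (nat set \<Rightarrow> real) \<Rightarrow> nat set \<Rightarrow> real" where
  "P t f A = f A + (\<Sum>i<t. wilson_coeff n k t i * B i f A)"

lemma K_iff: "A \<in> K \<longleftrightarrow> A \<subseteq> {1..n} \<and> finite A \<and> card A = k"
  by (auto simp: K_def nsets_def)

lemma finite_K [simp]: "finite K"
  by (rule finite_subset[of _ "Pow {1..n}"]) (auto simp: K_def nsets_def)

lemma finite_small [simp]: "finite (small e)"
  by (rule finite_subset[of _ "Pow {1..n}"]) (auto simp: small_def)

lemma small_1: "small (Suc 0) = {{}}"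
proof -
  have "S = {}" if "S \<subseteq> {1..n}" "card S < Suc 0" for S
    using that finite_subset[OF that(1)] by simp
  then show ?thesis by (auto simp: small_def)
qed

lemma card_K: "card K = n choose k"
  by (simp add: K_def)

lemma V_cong: "f \<in> V e" if "g \<in> V e" "\<And>A. A \<in> K \<Longrightarrow> f A = g A"
  using that by (auto simp: V_def)

lemma V_0: "f \<in> V 0 \<Longrightarrow> A \<in> K \<Longrightarrow> f A = 0"
  by (auto simp: V_def small_def)

lemma V_zero: "(\<lambda>A. 0) \<in> V e"
  by (auto simp: V_def intro!: exI[of _ "\<lambda>_. 0"])

lemma V_add: "f \<in> V e \<Longrightarrow> g \<in> V e \<Longrightarrow> (\<lambda>A. f A + g A) \<in> V e"
proof -
  assume "f \<in> V e" "g \<in> V e"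
  then obtain c d where "\<forall>A\<in>K. f A = (\<Sum>S\<in>small e. c S * ind S A)"
      "\<forall>A\<in>K. g A = (\<Sum>S\<in>small e. d S * ind S A)" unfolding V_def by blast
  then have "\<forall>A\<in>K. f A + g A = (\<Sum>S\<in>small e. (c S + d S) * ind S A)"
    by (simp add: sum.distrib distrib_right)
  then show ?thesis by (auto simp: V_def intro!: exI[of _ "\<lambda>S. c S + d S"])
qed

lemma V_scale: "f \<in> V e \<Longrightarrow> (\<lambda>A. a * f A) \<in> V e"
proof -
  assume "f \<in> V e"
  then obtain c where "\<forall>A\<in>K. f A = (\<Sum>S\<in>small e. c S * ind S A)" unfolding V_def by blast
  then have "\<forall>A\<in>K. a * f A = (\<Sum>S\<in>small e. (a * c S) * ind S A)"
    by (simp add: sum_distrib_left mult.assoc)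
  then show ?thesis by (auto simp: V_def intro!: exI[of _ "\<lambda>S. a * c S"])
qed

lemma V_sum: "(\<And>i. i \<in> I \<Longrightarrow> f i \<in> V e) \<Longrightarrow> (\<lambda>A. \<Sum>i\<in>I. f i A) \<in> V e"
  by (induction I rule: infinite_finite_induct) (auto intro: V_zero V_add)

lemma V_diff: "f \<in> V e \<Longrightarrow> g \<in> V e \<Longrightarrow> (\<lambda>A. f A - g A) \<in> V e"
  using V_add[of f e "\<lambda>A. - 1 * g A"] V_scale[of g e "- 1"] by simp

lemma V_mono: "e \<le> e' \<Longrightarrow> f \<in> V e \<Longrightarrow> f \<in> V e'"
proof -
  assume le: "e \<le> e'" and "f \<in> V e"
  then obtain c where c: "\<forall>A\<in>K. f A = (\<Sum>S\<in>small e. c S * ind S A)" unfolding V_def by blast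
  have "(\<Sum>S\<in>small e'. (if card S < e then c S else 0) * ind S A) = (\<Sum>S\<in>small e. c S * ind S A)" for A
    using le by (intro sum.mono_neutral_cong_right) (auto simp: small_def)
  then show ?thesis using c by (auto simp: V_def intro!: exI[of _ "\<lambda>S. if card S < e then c S else 0"])
qed

lemma ind_in_V:
  assumes "S \<subseteq> {1..n}" "card S < e"
  shows "ind S \<in> V e"
proof -
  have "ind S A = (\<Sum>T\<in>small e. (if T = S then 1 else 0) * ind T A)" for A
    using assms by (subst sum.remove[of _ S]) (auto simp: small_def intro!: sum.neutral)
  then show ?thesis unfolding V_def by (intro CollectI exI[of _ "\<lambda>T. if T = S then 1 else 0"] ballI)
qed

text \<open>Reduces linear statements on \<open>V e\<close> to indicators. The case
  \<open>cong\<close> is there because membership in \<open>V e\<close> constrains values on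
  \<open>K\<close> only.\<close>

lemma V_induct [consumes 1, case_names ind zero add scale cong]:
  assumes "f \<in> V e"
    and ind: "\<And>S. S \<subseteq> {1..n} \<Longrightarrow> card S < e \<Longrightarrow> Q (ind S)"
    and zero: "Q (\<lambda>A. 0)"
    and add: "\<And>f g. Q f \<Longrightarrow> Q g \<Longrightarrow> Q (\<lambda>A. f A + g A)"
    and scale: "\<And>a f. Q f \<Longrightarrow> Q (\<lambda>A. a * f A)"
    and cong: "\<And>f g. Q f \<Longrightarrow> (\<And>A. A \<in> K \<Longrightarrow> g A = f A) \<Longrightarrow> Q g"
  shows "Q f"
proof -
  obtain c where c: "\<And>A. A \<in> K \<Longrightarrow> f A = (\<Sum>S\<in>small e. c S * ind S A)"
    using assms(1) unfolding V_def by blast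
  have "Q (\<lambda>A. \<Sum>S\<in>I. c S * ind S A)" if "finite I" "I \<subseteq> small e" for I
    using that
  proof (induction I rule: finite_induct)
    case (insert S I)
    then show ?case by (auto simp: small_def intro!: add scale ind)
  qed (simp add: zero)
  from cong[OF this[of "small e"] c] show ?thesis by simp
qed

text \<open>On \<open>K\<close> the indicators of \<open>k\<close>-sets are point masses.\<close>

lemma every_in_V: "f \<in> V (Suc k)"
proof (rule V_cong)
  show "(\<lambda>A. \<Sum>S\<in>K. f S * ind S A) \<in> V (Suc k)"
    by (intro V_sum V_scale ind_in_V) (auto simp: K_iff)
  fix A assume A: "A \<in> K"
  have "ind S A = (if S = A then 1 else 0)" if "S \<in> K" for S
    using that A card_subset_eq[of A S] by (auto simp: ind_def K_iff)
  then have "(\<Sum>S\<in>K. f S * ind S A) = (\<Sum>S\<in>K. if S = A then f S else 0)"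
    by (intro sum.cong) auto
  then show "f A = (\<Sum>S\<in>K. f S * ind S A)" using A by simp
qed

lemma ip_commute: "ip f g = ip g f"
  by (simp add: ip_def mult.commute)

lemma ip_cong: "ip f g = ip f' g'" if "\<And>A. A \<in> K \<Longrightarrow> f A = f' A" "\<And>A. A \<in> K \<Longrightarrow> g A = g' A"
  using that by (simp add: ip_def)

lemma ip_add_right: "ip f (\<lambda>A. g A + h A) = ip f g + ip f h"
  by (simp add: ip_def sum.distrib distrib_left)

lemma ip_diff_right: "ip f (\<lambda>A. g A - h A) = ip f g - ip f h"
  by (simp add: ip_def sum_subtractf right_diff_distrib)

lemma ip_scale_right: "ip f (\<lambda>A. a * g A) = a * ip f g"
  by (simp add: ip_def sum_distrib_left mult.left_commute)

lemma ip_sum_right: "ip f (\<lambda>A. \<Sum>i\<in>I. g i A) = (\<Sum>i\<in>I. ip f (g i))"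
  by (simp add: ip_def sum_distrib_left) (rule sum.swap)

lemma ip_sum_left: "ip (\<lambda>A. \<Sum>i\<in>I. g i A) f = (\<Sum>i\<in>I. ip (g i) f)"
  by (simp add: ip_commute[of _ f] ip_sum_right)

definition orth_V :: "nat \<Rightarrow> (nat set \<Rightarrow> real) \<Rightarrow> bool" where
  "orth_V e f \<longleftrightarrow> (\<forall>g\<in>V e. ip f g = 0)"

lemma projection_V: "\<exists>g\<in>V e. orth_V e (\<lambda>A. f A - g A)"
proof -
  obtain c where c: "\<forall>S\<in>small e. (\<Sum>A\<in>K. (f A - (\<Sum>T\<in>small e. c T * ind T A)) * ind S A) = 0"
    using orthogonal_projection_exists[of "small e" K f ind] by auto
  let ?g = "\<lambda>A. \<Sum>T\<in>small e. c T * ind T A"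
  have "ip (\<lambda>A. f A - ?g A) h = 0" if "h \<in> V e" for h
    using that
  proof (induction rule: V_induct)
    case (ind S)
    then show ?case using c by (simp add: ip_def small_def)
  next
    case (cong h g)
    then show ?case using ip_cong[of "\<lambda>A. f A - ?g A" "\<lambda>A. f A - ?g A" g h] by simp
  qed (simp_all add: ip_add_right ip_scale_right, simp add: ip_def)
  then have "orth_V e (\<lambda>A. f A - ?g A)" by (simp add: orth_V_def)
  moreover have "?g \<in> V e" unfolding V_def by blast
  ultimately show ?thesis by (rule bexI)
qed

text \<open>The top component is \<open>f\<close> minus its projection to \<open>V e\<close>; the
  projection is decomposed by induction.\<close>

lemma orthogonal_components:
  assumes "f \<in> V e"
  shows "\<exists>c. (\<forall>j<e. c j \<in> V (Suc j) \<and> orth_V j (c j)) \<and> (\<forall>A\<in>K. f A = (\<Sum>j<e. c j A))"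
  using assms
proof (induction e arbitrary: f)
  case 0
  then show ?case using V_0 by auto
next
  case (Suc e)
  obtain g where g: "g \<in> V e" "orth_V e (\<lambda>A. f A - g A)" using projection_V by blast
  obtain c where c: "\<forall>j<e. c j \<in> V (Suc j) \<and> orth_V j (c j)" "\<forall>A\<in>K. g A = (\<Sum>j<e. c j A)"
    using Suc.IH[OF g(1)] by blast
  have "(\<lambda>A. f A - g A) \<in> V (Suc e)" using Suc.prems g(1) by (intro V_diff) (auto intro: V_mono[of e])
  then show ?case using c g
    by (intro exI[of _ "\<lambda>j. if j = e then (\<lambda>A. f A - g A) else c j"]) (auto simp: less_Suc_eq)
qed

section \<open>The operators \<open>B i\<close> and \<open>P t\<close> on the filtration
  \<open>V\<close>\<close>

lemma B_add: "B i (\<lambda>A. f A + g A) A = B i f A + B i g A"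
  by (simp add: B_def sum.distrib distrib_left)

lemma B_scale: "B i (\<lambda>A. a * f A) A = a * B i f A"
  by (simp add: B_def sum_distrib_left mult.left_commute)

lemma B_cong: "(\<And>A. A \<in> K \<Longrightarrow> f A = g A) \<Longrightarrow> B i f A = B i g A"
  by (simp add: B_def)

lemma card_Diff_sym: "A \<in> K \<Longrightarrow> A' \<in> K \<Longrightarrow> card (A - A') = card (A' - A)"
  using card_Diff_subset_Int[of A A'] card_Diff_subset_Int[of A' A] by (auto simp: K_iff Int_commute)

lemma B_symmetric: "ip f (B i g) = ip (B i f) g"
proof -
  have "ip f (B i g) = (\<Sum>A\<in>K. \<Sum>A'\<in>K. f A * (real (card (A - A') choose (k - i)) * g A'))"
    by (simp add: ip_def B_def sum_distrib_left)
  also have "\<dots> = (\<Sum>A'\<in>K. \<Sum>A\<in>K. f A * (real (card (A - A') choose (k - i)) * g A'))"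
    by (rule sum.swap)
  also have "\<dots> = ip (B i f) g"
    unfolding ip_def B_def sum_distrib_right
    by (intro sum.cong refl) (metis card_Diff_sym mult.assoc mult.commute)
  finally show ?thesis .
qed

text \<open>Double counting: choose a \<open>(k - i)\<close>-subset \<open>X\<close> of
  \<open>A\<close> first, then a \<open>k\<close>-set \<open>A'\<close> that contains
  \<open>S\<close> and avoids \<open>X\<close>; such \<open>A'\<close> exist only for
  \<open>X\<close> disjoint from \<open>S\<close>.\<close>

lemma B_ind:
  assumes "A \<in> K" "S \<subseteq> {1..n}" "card S \<le> k" "i \<le> k"
  shows "B i (ind S) A = real ((n - k + i - card S) choose (k - card S)) * real (card (A - S) choose (k - i))"
proof -
  have fin: "finite A" "finite S" using assms finite_subset by (auto simp: K_iff)
  define J where "J = {X. X \<subseteq> A \<and> card X = k - i}"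
  have fJ: "finite J" using fin by (auto simp: J_def)
  have cnt: "real (card (A - A') choose (k - i)) = (\<Sum>X\<in>J. of_bool (X \<inter> A' = {}))" for A'
  proof -
    have "card (A - A') choose (k - i) = card {X. X \<subseteq> A - A' \<and> card X = k - i}"
      using fin by (subst n_subsets) auto
    also have "{X. X \<subseteq> A - A' \<and> card X = k - i} = J \<inter> {X. X \<inter> A' = {}}"
      by (auto simp: J_def)
    finally show ?thesis using fJ by (simp add: of_bool_def sum.If_cases)
  qed
  have inner: "(\<Sum>A'\<in>K. of_bool (X \<inter> A' = {}) * ind S A')
      = real ((n - k + i - card S) choose (k - card S)) * of_bool (X \<inter> S = {})" if "X \<in> J" for X
  proof -
    have X: "finite X" "X \<subseteq> {1..n}" "card X = k - i"
      using that fin assms finite_subset by (auto simp: J_def K_iff)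
    have "(\<Sum>A'\<in>K. of_bool (X \<inter> A' = {}) * ind S A') = real (card (K \<inter> {A'. X \<inter> A' = {} \<and> S \<subseteq> A'}))"
      by (simp only: ind_def of_bool_conj[symmetric]) (simp add: of_bool_def sum.If_cases)
    also have "K \<inter> {A'. X \<inter> A' = {} \<and> S \<subseteq> A'} = {A'. S \<subseteq> A' \<and> A' \<subseteq> {1..n} - X \<and> card A' = k}"
      using finite_subset[OF _ finite_atLeastAtMost[of 1 n]]
      unfolding set_eq_iff K_iff Int_iff mem_Collect_eq by blast
    also have "real (card \<dots>) = real ((n - k + i - card S) choose (k - card S)) * of_bool (X \<inter> S = {})"
    proof (cases "X \<inter> S = {}")
      case True
      have "card ({1..n} - X) = n - k + i" using X assms two_k_le by (simp add: card_Diff_subset)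
      then show ?thesis using True assms
        by (subst card_supersets) auto
    next
      case False
      then have "{A'. S \<subseteq> A' \<and> A' \<subseteq> {1..n} - X \<and> card A' = k} = {}" by auto
      with False show ?thesis by simp
    qed
    finally show ?thesis .
  qed
  have "B i (ind S) A = (\<Sum>A'\<in>K. \<Sum>X\<in>J. of_bool (X \<inter> A' = {}) * ind S A')"
    unfolding B_def cnt sum_distrib_right ..
  also have "\<dots> = (\<Sum>X\<in>J. \<Sum>A'\<in>K. of_bool (X \<inter> A' = {}) * ind S A')"
    by (rule sum.swap)
  also have "\<dots> = (\<Sum>X\<in>J. real ((n - k + i - card S) choose (k - card S)) * of_bool (X \<inter> S = {}))"
    using inner by (rule sum.cong[OF refl])
  finally show ?thesis by (simp add: cnt sum_distrib_left)
qed

text \<open>Inclusion-exclusion over the subsets \<open>R\<close> of \<open>S\<close> expands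
  \<open>B_ind\<close> into indicators. The term \<open>R = S\<close> carries the eigenvalue, proper
  subsets fall into \<open>V (card S)\<close>; thus \<open>B i\<close> is triangular.\<close>

lemma B_ind_leading:
  assumes "S \<subseteq> {1..n}" "card S \<le> k" "i \<le> k"
  shows "(\<lambda>A. B i (ind S) A - johnson_eigenvalue n k i (card S) * ind S A) \<in> V (card S)"
proof -
  let ?m = "real ((n - k + i - card S) choose (k - card S))"
  have fin: "finite S" using assms finite_subset by auto
  show ?thesis
  proof (rule V_cong)
    show "(\<lambda>A. \<Sum>R\<in>Pow S - {S}. (?m * ((-1) ^ card R * real ((k - card R) choose i))) * ind R A) \<in> V (card S)"
      using assms fin by (intro V_sum V_scale ind_in_V) (auto intro!: psubset_card_mono)
    fix A assume A: "A \<in> K"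
    then have finA: "finite A" by (simp add: K_iff)
    have "k - card (S \<inter> A) = card (A - S)"
      using A card_Diff_subset_Int[of A S] finA by (simp add: K_iff Int_commute)
    moreover have "card (S \<inter> A) \<le> k" using A finA card_mono[of A "S \<inter> A"] by (auto simp: K_iff)
    ultimately have "real (card (A - S) choose (k - i))
        = (\<Sum>R\<in>Pow (S \<inter> A). (-1) ^ card R * real ((k - card R) choose i))"
      using choose_inclusion_exclusion[of "S \<inter> A" k i] assms fin by simp
    also have "\<dots> = (\<Sum>R\<in>Pow S. (-1) ^ card R * real ((k - card R) choose i) * ind R A)"
      using fin by (intro sum.mono_neutral_cong_left) (auto simp: ind_def)
    also have "\<dots> = (-1) ^ card S * real ((k - card S) choose i) * ind S A
        + (\<Sum>R\<in>Pow S - {S}. (-1) ^ card R * real ((k - card R) choose i) * ind R A)"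
      using fin by (subst sum.remove[of _ S]) auto
    finally show "B i (ind S) A - johnson_eigenvalue n k i (card S) * ind S A
        = (\<Sum>R\<in>Pow S - {S}. (?m * ((-1) ^ card R * real ((k - card R) choose i))) * ind R A)"
      unfolding B_ind[OF A assms] johnson_eigenvalue_def
      by (simp add: sum_distrib_left distrib_left mult_ac)
  qed
qed

lemma P_add: "P t (\<lambda>A. f A + g A) A = P t f A + P t g A"
  by (simp add: P_def B_add sum.distrib distrib_left)

lemma P_scale: "P t (\<lambda>A. a * f A) A = a * P t f A"
  by (simp add: P_def B_scale sum_distrib_left distrib_left mult.left_commute)

lemma P_zero: "P t (\<lambda>A. 0) A = 0"
  using P_scale[of t 0 "\<lambda>A. 0"] by simp

lemma P_sum: "P t (\<lambda>A. \<Sum>i\<in>I. f i A) A = (\<Sum>i\<in>I. P t (f i) A)"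
  by (induction I rule: infinite_finite_induct) (simp_all add: P_zero P_add)

lemma P_cong: "A \<in> K \<Longrightarrow> (\<And>A. A \<in> K \<Longrightarrow> f A = g A) \<Longrightarrow> P t f A = P t g A"
  using B_cong[of f g] by (simp add: P_def)

lemma P_symmetric: "ip f (P t g) = ip (P t f) g"
proof -
  have "ip f (P t g) = ip f g + (\<Sum>i<t. wilson_coeff n k t i * ip f (B i g))" for f g
    unfolding P_def by (simp add: ip_add_right ip_sum_right ip_scale_right)
  note ip_P = this
  have "ip (P t f) g = ip g (P t f)" by (rule ip_commute)
  also have "\<dots> = ip g f + (\<Sum>i<t. wilson_coeff n k t i * ip g (B i f))" by (rule ip_P)
  also have "\<dots> = ip f g + (\<Sum>i<t. wilson_coeff n k t i * ip f (B i g))"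
    unfolding B_symmetric by (simp only: ip_commute[of g f] ip_commute[of "B _ g" f] B_symmetric)
  finally show ?thesis by (simp only: ip_P)
qed

lemma P_ind_leading:
  assumes "S \<subseteq> {1..n}" "card S \<le> k" "t \<le> k"
  shows "(\<lambda>A. P t (ind S) A - wilson_eigenvalue n k t (card S) * ind S A) \<in> V (card S)"
proof (rule V_cong)
  show "(\<lambda>A. \<Sum>i<t. wilson_coeff n k t i *
      (B i (ind S) A - johnson_eigenvalue n k i (card S) * ind S A)) \<in> V (card S)"
    using assms by (intro V_sum V_scale B_ind_leading) auto
qed (simp add: P_def wilson_eigenvalue_def algebra_simps sum_subtractf sum_distrib_left)

text \<open>Triangularity of \<open>P t\<close>: on indicators of \<open>e\<close>-sets this is
  \<open>P_ind_leading\<close>, and for smaller sets both terms already lie in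
  \<open>V e\<close>.\<close>

lemma P_leading:
  assumes "f \<in> V (Suc e)" "e \<le> k" "t \<le> k"
  shows "(\<lambda>A. P t f A - wilson_eigenvalue n k t e * f A) \<in> V e"
  using assms(1)
proof (induction rule: V_induct)
  case (ind S)
  show ?case
  proof (cases "card S = e")
    case True
    then show ?thesis using P_ind_leading[of S t] ind assms by simp
  next
    case False
    then have less: "card S < e" using ind by simp
    have "(\<lambda>A. P t (ind S) A - wilson_eigenvalue n k t (card S) * ind S A) \<in> V e"
      using P_ind_leading[of S t] ind assms less by (auto intro: V_mono[of "card S"])
    moreover have "(\<lambda>A. (wilson_eigenvalue n k t (card S) - wilson_eigenvalue n k t e) * ind S A) \<in> V e"
      using ind less by (intro V_scale ind_in_V)
    ultimately have "(\<lambda>A. (P t (ind S) A - wilson_eigenvalue n k t (card S) * ind S A)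
        + (wilson_eigenvalue n k t (card S) - wilson_eigenvalue n k t e) * ind S A) \<in> V e"
      by (rule V_add)
    then show ?thesis by (simp add: left_diff_distrib)
  qed
next
  case zero
  then show ?case by (simp add: P_zero V_zero)
next
  case (add f g)
  from V_add[OF this] show ?case by (simp add: P_add algebra_simps)
next
  case (scale a f)
  from V_scale[OF this, of a] show ?case by (simp add: P_scale algebra_simps)
next
  case (cong f g)
  have "P t g A = P t f A" if "A \<in> K" for A using that cong(2) by (rule P_cong)
  with cong show ?case by (intro V_cong[OF cong(1)]) simp
qed

lemma P_in_V: "P t f \<in> V (Suc e)" if "f \<in> V (Suc e)" "e \<le> k" "t \<le> k"
proof -
  have "(\<lambda>A. (P t f A - wilson_eigenvalue n k t e * f A) + wilson_eigenvalue n k t e * f A) \<in> V (Suc e)"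
    using P_leading[OF that] that by (intro V_add V_scale) (auto intro: V_mono[of e])
  then show ?thesis by simp
qed

text \<open>The point of Wilson's coefficients. With \<open>u = card (A - S)\<close> their sum is
  the alternating sum for \<open>r = k - t\<close>: it is 1 when \<open>S\<close> is not contained
  in \<open>A\<close>, and empty otherwise, where the identity part supplies the 1.\<close>

lemma P_ind_exact:
  assumes "S \<subseteq> {1..n}" "card S = t" "t \<le> k" "A \<in> K"
  shows "P t (ind S) A = 1"
proof -
  have fin: "finite S" "finite A" "card A = k" using assms finite_subset by (auto simp: K_iff)
  define u where "u = card (A - S)"
  have u: "u = k - card (A \<inter> S)" using fin card_Diff_subset_Int[of A S] by (simp add: u_def)
  have pos: "real ((n - k + i - t) choose (k - t)) > 0" for i
    using two_k_le assms by (simp add: zero_less_binomial_iff)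
  have "(\<Sum>i<t. wilson_coeff n k t i * B i (ind S) A)
      = (\<Sum>i<t. (-1) ^ (t - 1 - i) * real ((k - 1 - i) choose (k - t)) * real (u choose (k - i)))"
  proof (intro sum.cong refl)
    fix i assume i: "i \<in> {..<t}"
    have "n - k + i - t = n - k - t + i" using two_k_le assms by simp
    then show "wilson_coeff n k t i * B i (ind S) A
        = (-1) ^ (t - 1 - i) * real ((k - 1 - i) choose (k - t)) * real (u choose (k - i))"
      using i assms pos[of i] by (subst B_ind) (auto simp: wilson_coeff_def u_def)
  qed
  also have "\<dots> = (\<Sum>j=Suc (k - t)..k. (-1) ^ (j - Suc (k - t)) * real ((j - 1) choose (k - t)) * real (u choose j))"
    using assms
    by (intro sum.reindex_bij_witness[of _ "\<lambda>j. k - j" "\<lambda>i. k - i"]) (auto simp: le_diff_conv)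
  also have "\<dots> = (\<Sum>j=Suc (k - t)..u. (-1) ^ (j - Suc (k - t)) * real ((j - 1) choose (k - t)) * real (u choose j))"
    using u by (intro sum.mono_neutral_right) auto
  also have "\<dots> = (if S \<subseteq> A then 0 else 1)"
  proof (cases "S \<subseteq> A")
    case True
    then have "A \<inter> S = S" by auto
    then have "u = k - t" using u assms by simp
    then show ?thesis using True by simp
  next
    case False
    then have "card (A \<inter> S) < t" using fin assms psubset_card_mono[of S "A \<inter> S"] by auto
    then have "k - t < u" using u assms by linarith
    from alternating_choose_shift[OF this] show ?thesis using False by simp
  qed
  finally show ?thesis by (simp add: P_def ind_def)
qed

text \<open>Counts the \<open>t\<close>-sets between \<open>S\<close> and \<open>A\<close>. Hence
  indicators of \<open>t\<close>-sets span \<open>V (Suc t)\<close>.\<close>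

lemma ind_as_sum_of_larger:
  assumes "S \<subseteq> {1..n}" "card S \<le> t" "t \<le> k" "A \<in> K"
  shows "ind S A = 1 / real ((k - card S) choose (t - card S))
      * (\<Sum>T\<in>{T. S \<subseteq> T \<and> T \<subseteq> {1..n} \<and> card T = t}. ind T A)"
proof -
  let ?X = "{T. S \<subseteq> T \<and> T \<subseteq> {1..n} \<and> card T = t}"
  have fX: "finite ?X" by (rule finite_subset[of _ "Pow {1..n}"]) auto
  have A: "finite A" "A \<subseteq> {1..n}" "card A = k" using assms by (auto simp: K_iff)
  have "(\<Sum>T\<in>?X. ind T A) = real (card (?X \<inter> {T. T \<subseteq> A}))"
    using fX by (simp add: ind_def of_bool_def sum.If_cases)
  also have "?X \<inter> {T. T \<subseteq> A} = {T. S \<subseteq> T \<and> T \<subseteq> A \<and> card T = t}" using A by auto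
  also have "real (card \<dots>) = real ((k - card S) choose (t - card S)) * ind S A"
  proof (cases "S \<subseteq> A")
    case True
    then show ?thesis using A assms by (subst card_supersets) (auto simp: ind_def)
  next
    case False
    then have "{T. S \<subseteq> T \<and> T \<subseteq> A \<and> card T = t} = {}" by auto
    then show ?thesis using False by (simp only: ind_def) simp
  qed
  moreover have "((k - card S) choose (t - card S)) > 0" using assms by (simp add: zero_less_binomial_iff)
  ultimately show ?thesis by simp
qed

lemma P_ind_const:
  assumes "S \<subseteq> {1..n}" "card S \<le> t" "t \<le> k" "A \<in> K"
  shows "P t (ind S) A = real ((n - card S) choose (t - card S)) / real ((k - card S) choose (t - card S))"
proof -
  let ?X = "{T. S \<subseteq> T \<and> T \<subseteq> {1..n} \<and> card T = t}"
  let ?c = "1 / real ((k - card S) choose (t - card S))"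
  have "P t (ind S) A = P t (\<lambda>A. ?c * (\<Sum>T\<in>?X. ind T A)) A"
    using assms by (intro P_cong ind_as_sum_of_larger) auto
  also have "\<dots> = ?c * (\<Sum>T\<in>?X. P t (ind T) A)" by (simp only: P_scale P_sum)
  also have "(\<Sum>T\<in>?X. P t (ind T) A) = real (card ?X)"
    using assms by (simp add: P_ind_exact)
  also have "card ?X = (n - card S) choose (t - card S)"
    using assms by (subst card_supersets) auto
  finally show ?thesis by simp
qed

text \<open>The spanning indicators of \<open>t\<close>-sets all go to 1. As constants are
  orthogonal to the eigenspaces 1 to \<open>t\<close>, this is why \<open>P t\<close> vanishes
  there.\<close>

lemma P_const:
  assumes "f \<in> V (Suc t)" "t \<le> k"
  shows "\<exists>c. \<forall>A\<in>K. P t f A = c"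
  using assms(1)
proof (induction rule: V_induct)
  case (ind S)
  then show ?case using P_ind_const[of S t] assms by auto
next
  case zero
  then show ?case by (simp add: P_zero)
next
  case (add f g)
  then show ?case by (metis P_add)
next
  case (scale a f)
  then show ?case by (metis P_scale)
next
  case (cong f g)
  then show ?case by (metis P_cong)
qed

section \<open>The quadratic form of \<open>P t\<close> on orthogonal components\<close>

definition N :: "nat \<Rightarrow> real" where
  "N s = real ((n - s) choose (k - s))"

text \<open>The eigenvalue of \<open>P t\<close> on the \<open>e\<close>-th eigenspace. The values
  for \<open>e <= t\<close> are stated directly, as \<open>P_1\<close> and \<open>P_const\<close>
  yield them without evaluating the alternating sum.\<close>

definition ev :: "nat \<Rightarrow> nat \<Rightarrow> real" where
  "ev t e = (if e = 0 then N 0 / N t else if e \<le> t then 0 else wilson_eigenvalue n k t e)"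

lemma N_pos: "s \<le> k \<Longrightarrow> N s > 0"
  using two_k_le by (simp add: N_def zero_less_binomial_iff)

lemma P_1: "P t (\<lambda>A. 1) A = N 0 / N t" if "t \<le> k" "A \<in> K"
proof -
  have ind: "ind {} = (\<lambda>A. 1)" by (auto simp: ind_def)
  have "P t (ind {}) A = real (n choose t) / real (k choose t)"
    using P_ind_const[of "{}" t A] that by simp
  then have "P t (\<lambda>A. 1) A = real (n choose t) / real (k choose t)" by (simp only: ind)
  moreover have "(n choose k) * (k choose t) = (n choose t) * ((n - t) choose (k - t))"
    using that two_k_le by (intro choose_mult) auto
  then have "real (n choose k) * real (k choose t) = real (n choose t) * real ((n - t) choose (k - t))"
    unfolding of_nat_mult[symmetric] by simp
  then have "N 0 / N t = real (n choose t) / real (k choose t)"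
    using that N_pos[OF that(1)] by (simp add: N_def frac_eq_eq)
  ultimately show ?thesis by simp
qed

text \<open>For \<open>e = 0\<close> both functions are constant on \<open>K\<close>; for
  \<open>0 < e <= t\<close>, \<open>P t g\<close> is constant and thus orthogonal to
  \<open>f\<close>; for \<open>t < e\<close> the error in \<open>P_leading\<close> lies in
  \<open>V e\<close>, again orthogonal to \<open>f\<close>.\<close>

lemma ip_P_component:
  assumes f: "f \<in> V (Suc e)" "orth_V e f" and g: "g \<in> V (Suc e)" and "e \<le> k" "t \<le> k"
  shows "ip f (P t g) = ev t e * ip f g"
proof -
  consider "e = 0" | "0 < e" "e \<le> t" | "t < e" by linarith
  then show ?thesis
  proof cases
    case 1
    obtain c where c: "g A = c" if "A \<in> K" for A
      using g 1 by (auto simp: V_def small_1 ind_def)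
    have "P t g A = N 0 / N t * g A" if "A \<in> K" for A
    proof -
      have "P t g A = P t (\<lambda>A. c * 1) A" using that c by (intro P_cong) auto
      then show ?thesis using that c P_1 assms P_scale[of t c "\<lambda>A. 1" A] by simp
    qed
    then have "ip f (P t g) = ip f (\<lambda>A. N 0 / N t * g A)" by (intro ip_cong) auto
    then show ?thesis using 1 by (simp only: ip_scale_right ev_def) simp
  next
    case 2
    obtain c where c: "P t g A = c" if "A \<in> K" for A
      using P_const[of g t] V_mono[of "Suc e" "Suc t" g] g 2 assms by auto
    have "ip f (P t g) = ip f (\<lambda>A. c * ind {} A)"
      using c by (intro ip_cong) (auto simp: ind_def)
    moreover have "(\<lambda>A. c * ind {} A) \<in> V e" using 2 by (intro V_scale ind_in_V) auto
    with f have "ip f (\<lambda>A. c * ind {} A) = 0" unfolding orth_V_def by blast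
    ultimately show ?thesis using 2 by (simp add: ev_def)
  next
    case 3
    have "ip f (\<lambda>A. P t g A - wilson_eigenvalue n k t e * g A) = 0"
      using f P_leading[of g e t] g assms unfolding orth_V_def by blast
    then show ?thesis using 3 by (simp add: ip_diff_right ip_scale_right ev_def)
  qed
qed

text \<open>Mixed terms vanish because \<open>P t\<close> preserves every \<open>V (Suc e)\<close>
  and the component of higher index is orthogonal to it; symmetry of \<open>P t\<close> covers both
  orders.\<close>

lemma ip_P_components:
  assumes f: "\<And>e. e \<le> k \<Longrightarrow> cf e \<in> V (Suc e) \<and> orth_V e (cf e)" "\<And>A. A \<in> K \<Longrightarrow> f A = (\<Sum>e\<le>k. cf e A)"
    and g: "\<And>e. e \<le> k \<Longrightarrow> cg e \<in> V (Suc e) \<and> orth_V e (cg e)" "\<And>A. A \<in> K \<Longrightarrow> g A = (\<Sum>e\<le>k. cg e A)"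
    and t: "t \<le> k"
  shows "ip f (P t g) = (\<Sum>e\<le>k. ev t e * ip (cf e) (cg e))"
proof -
  have "ip f (P t g) = ip (\<lambda>A. \<Sum>e\<le>k. cf e A) (\<lambda>A. \<Sum>e'\<le>k. P t (cg e') A)"
    using f g P_cong[of _ g "\<lambda>A. \<Sum>e\<le>k. cg e A" t] by (intro ip_cong) (simp_all add: P_sum)
  also have "\<dots> = (\<Sum>e\<le>k. \<Sum>e'\<le>k. ip (cf e) (P t (cg e')))"
    by (simp only: ip_sum_left ip_sum_right)
  also have "\<dots> = (\<Sum>e\<le>k. \<Sum>e'\<le>k. if e' = e then ev t e * ip (cf e) (cg e) else 0)"
  proof (intro sum.cong refl)
    fix e e' assume e: "e \<in> {..k}" "e' \<in> {..k}"
    consider "e' = e" | "e' < e" | "e < e'" by linarith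
    then show "ip (cf e) (P t (cg e')) = (if e' = e then ev t e * ip (cf e) (cg e) else 0)"
    proof cases
      case 1
      then show ?thesis using e f g t by (simp add: ip_P_component)
    next
      case 2
      have "P t (cg e') \<in> V e" using P_in_V[of "cg e'" e' t] g e t 2 V_mono[of "Suc e'" e] by auto
      then show ?thesis using 2 f e unfolding orth_V_def by auto
    next
      case 3
      have "P t (cf e) \<in> V e'" using P_in_V[of "cf e" e t] f e t 3 V_mono[of "Suc e" e'] by auto
      moreover have "ip (cf e) (P t (cg e')) = ip (cg e') (P t (cf e))"
        by (metis P_symmetric ip_commute)
      ultimately show ?thesis using 3 g e unfolding orth_V_def by simp
    qed
  qed
  also have "\<dots> = (\<Sum>e\<le>k. ev t e * ip (cf e) (cg e))" by simp
  finally show ?thesis .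
qed

lemma N_Suc: "s < k \<Longrightarrow> N (Suc s) * real (n - s) = N s * real (k - s)"
proof -
  assume "s < k"
  then have "(n - s) * ((n - Suc s) choose (k - Suc s)) = (k - s) * ((n - s) choose (k - s))"
    using times_binomial_minus1_eq[of "k - s" "n - s"] by simp
  then have "real (n - s) * real ((n - Suc s) choose (k - Suc s)) = real (k - s) * real ((n - s) choose (k - s))"
    unfolding of_nat_mult[symmetric] by simp
  then show ?thesis by (simp add: N_def mult.commute)
qed

section \<open>The theta bound for levelled families\<close>

text \<open>Sets of the two levels meet in at least \<open>t > i\<close> elements, where the kernel
  of \<open>B i\<close> vanishes, so only the identity part of \<open>P t\<close>
  contributes.\<close>

lemma P_between_levels:
  assumes "\<A> \<subseteq> K" and "\<And>A A'. A \<in> \<A> \<Longrightarrow> A' \<in> \<A> \<Longrightarrow> lev A = s \<Longrightarrow> lev A' = s' \<Longrightarrow> t \<le> card (A \<inter> A')"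
    and "t \<le> k" "A \<in> \<A>" "lev A = s"
  shows "P t (\<lambda>A. of_bool (A \<in> \<A> \<and> lev A = s')) A = of_bool (s' = s)"
proof -
  have "B i (\<lambda>A. of_bool (A \<in> \<A> \<and> lev A = s')) A = 0" if "i < t" for i
    unfolding B_def
  proof (intro sum.neutral ballI)
    fix A' assume A': "A' \<in> K"
    show "real (card (A - A') choose (k - i)) * of_bool (A' \<in> \<A> \<and> lev A' = s') = 0"
    proof (cases "A' \<in> \<A> \<and> lev A' = s'")
      case True
      then have "t \<le> card (A \<inter> A')" using assms by blast
      moreover have "card (A - A') = k - card (A \<inter> A')"
        using assms card_Diff_subset_Int[of A A'] by (auto simp: K_iff)
      ultimately have "card (A - A') < k - i" using that assms by linarith
      then show ?thesis by simp
    qed auto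
  qed
  then show ?thesis using assms by (auto simp: P_def)
qed

text \<open>A vertex-weighted theta bound: the block matrix with blocks \<open>P\<^bsub>max s s'\<^esub> / N\<^bsub>min s s'\<^esub>\<close>
  dominates the rank one matrix of the weights \<open>1 / N s\<close>.\<close>
lemma levelled_lym:
  assumes A: "\<A> \<subseteq> K" and lev: "\<And>A. A \<in> \<A> \<Longrightarrow> lev A \<le> k"
    and inter: "\<And>A A'. A \<in> \<A> \<Longrightarrow> A' \<in> \<A> \<Longrightarrow> max (lev A) (lev A') \<le> card (A \<inter> A')"
    and pos: "\<And>s e. s < e \<Longrightarrow> e \<le> k \<Longrightarrow> 0 < ev s e"
    and mono: "\<And>s e. Suc s < e \<Longrightarrow> e \<le> k \<Longrightarrow> ev (Suc s) e * N (Suc s) \<le> ev s e * N s"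
  shows "(\<Sum>A\<in>\<A>. 1 / N (lev A)) \<le> 1"
proof -
  define x where "x s A = (of_bool (A \<in> \<A> \<and> lev A = s) :: real)" for s A
  define a where "a s = ip (x s) (ind {})" for s
  define Z where "Z = (\<Sum>A\<in>\<A>. 1 / N (lev A))"
  have finA: "finite \<A>" using A by (rule finite_subset) simp
  have "\<exists>c. (\<forall>e\<le>k. c e \<in> V (Suc e) \<and> orth_V e (c e)) \<and> (\<forall>A\<in>K. x s A = (\<Sum>e\<le>k. c e A))" for s
    using orthogonal_components[OF every_in_V, of "x s"]
    by (simp only: lessThan_Suc_atMost less_Suc_eq_le)
  then obtain c where c: "\<And>s e. e \<le> k \<Longrightarrow> c s e \<in> V (Suc e) \<and> orth_V e (c s e)"
      "\<And>s A. A \<in> K \<Longrightarrow> x s A = (\<Sum>e\<le>k. c s e A)"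
    by metis
  \<comment> \<open>The share of the \<open>e\<close>-th eigenspace in the block form.\<close>
  define T where "T e = (\<Sum>s\<le>k. \<Sum>s'\<le>k. ev (max s s') e / N (min s s') * ip (c s e) (c s' e))" for e

  have a_card: "a s = real (card {A\<in>\<A>. lev A = s})" for s
  proof -
    have "a s = real (card (K \<inter> {A. A \<in> \<A> \<and> lev A = s}))"
      by (simp add: a_def ip_def x_def ind_def of_bool_def sum.If_cases)
    also have "K \<inter> {A. A \<in> \<A> \<and> lev A = s} = {A\<in>\<A>. lev A = s}" using A by auto
    finally show ?thesis .
  qed
  have Z_a: "Z = (\<Sum>s\<le>k. a s / N s)"
  proof -
    have "Z = (\<Sum>s\<le>k. \<Sum>A\<in>{A\<in>\<A>. lev A = s}. 1 / N (lev A))"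
      unfolding Z_def using finA lev by (subst sum.group[where g = lev and T = "{..k}"]) auto
    then show ?thesis by (simp add: a_card)
  qed
  have block: "ip (x s) (P (max s s') (x s')) = (if s' = s then a s else 0)" if "s \<le> k" "s' \<le> k" for s s'
  proof -
    have "x s A * P (max s s') (x s') A = (if s' = s then x s A * ind {} A else 0)" for A
    proof (cases "A \<in> \<A> \<and> lev A = s")
      case True
      have "P (max s s') (x s') A = of_bool (s' = s)"
        unfolding x_def using True A inter that by (intro P_between_levels) auto
      then show ?thesis by (simp add: ind_def)
    qed (auto simp: x_def)
    then show ?thesis unfolding a_def ip_def by simp
  qed
  have Z_T: "Z = (\<Sum>e\<le>k. T e)"
  proof -
    have "Z = (\<Sum>s\<le>k. \<Sum>s'\<le>k. (1 / N (min s s')) * ip (x s) (P (max s s') (x s')))"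
      unfolding Z_a
    proof (intro sum.cong refl)
      fix s assume s: "s \<in> {..k}"
      have "(\<Sum>s'\<le>k. (1 / N (min s s')) * ip (x s) (P (max s s') (x s')))
          = (\<Sum>s'\<le>k. if s' = s then a s / N s else 0)"
        using s by (intro sum.cong refl) (simp add: block)
      then show "a s / N s = (\<Sum>s'\<le>k. (1 / N (min s s')) * ip (x s) (P (max s s') (x s')))"
        using s by simp
    qed
    also have "\<dots> = (\<Sum>s\<le>k. \<Sum>s'\<le>k. \<Sum>e\<le>k. ev (max s s') e / N (min s s') * ip (c s e) (c s' e))"
    proof (intro sum.cong refl)
      fix s s' assume "s \<in> {..k}" "s' \<in> {..k}"
      then have "ip (x s) (P (max s s') (x s')) = (\<Sum>e\<le>k. ev (max s s') e * ip (c s e) (c s' e))"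
        using c by (intro ip_P_components) auto
      then show "1 / N (min s s') * ip (x s) (P (max s s') (x s'))
          = (\<Sum>e\<le>k. ev (max s s') e / N (min s s') * ip (c s e) (c s' e))"
        by (simp add: sum_divide_distrib)
    qed
    also have "\<dots> = (\<Sum>s\<le>k. \<Sum>e\<le>k. \<Sum>s'\<le>k. ev (max s s') e / N (min s s') * ip (c s e) (c s' e))"
      by (intro sum.cong refl sum.swap)
    also have "\<dots> = (\<Sum>e\<le>k. T e)" unfolding T_def by (rule sum.swap)
    finally show ?thesis .
  qed
  have T_pos: "0 \<le> T e" if e: "1 \<le> e" "e \<le> k" for e
  proof -
    \<comment> \<open>For \<open>e >= 1\<close>, \<open>ev t e\<close> is 0 whenever
      \<open>t >= e\<close>, so only levels below \<open>e\<close> remain.\<close>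
    have "T e = (\<Sum>s<e. \<Sum>s'<e. ev (max s s') e / N (min s s') * ip (c s e) (c s' e))"
      unfolding T_def
    proof (rule sum.mono_neutral_cong_right)
      show "\<forall>s\<in>{..k} - {..<e}. (\<Sum>s'\<le>k. ev (max s s') e / N (min s s') * ip (c s e) (c s' e)) = 0"
        using e by (intro ballI sum.neutral) (auto simp: ev_def)
      show "(\<Sum>s'\<le>k. ev (max s s') e / N (min s s') * ip (c s e) (c s' e))
          = (\<Sum>s'<e. ev (max s s') e / N (min s s') * ip (c s e) (c s' e))" for s
        using e by (intro sum.mono_neutral_right) (auto simp: ev_def)
    qed (use e in auto)
    also have "\<dots> = (\<Sum>s<e. \<Sum>A\<in>K. \<Sum>s'<e. 1 / N (min s s') * ev (max s s') e * c s e A * c s' e A)"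
      unfolding ip_def sum_distrib_left
      by (subst sum.swap[of _ K]) (simp add: mult_ac)
    also have "\<dots> = (\<Sum>A\<in>K. \<Sum>s<e. \<Sum>s'<e. 1 / N (min s s') * ev (max s s') e * c s e A * c s' e A)"
      by (rule sum.swap)
    also have "\<dots> \<ge> 0"
    \<comment> \<open>At each fixed \<open>A\<close> this is a Green kernel with
      \<open>u s = 1 / N s\<close> and \<open>v s = ev s e\<close>; monotonicity of
      \<open>u / v\<close> is the hypothesis \<open>mono\<close>.\<close>
    proof (rule sum_nonneg, rule green_kernel_nonneg)
      fix s assume s: "Suc s < e"
      then have "N s > 0" "N (Suc s) > 0" using e by (auto intro!: N_pos)
      then show "1 / N s * ev (Suc s) e \<le> 1 / N (Suc s) * ev s e"
        using mono[OF s e(2)] by (simp add: field_simps)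
    next
      show "0 < ev s e" if "s < e" for s using pos that e by blast
      show "0 \<le> 1 / N s" if "s < e" for s using N_pos[of s] that e by simp
    qed
    finally show ?thesis .
  qed
  have T_0: "T 0 = Z\<^sup>2"
  proof -
    have N0: "N 0 > 0" by (rule N_pos) simp
    have "\<exists>d. \<forall>A\<in>K. c s 0 A = d" for s
      using c(1)[of 0 s] by (auto simp: V_def small_1 ind_def)
    then obtain d where d: "\<And>s A. A \<in> K \<Longrightarrow> c s 0 A = d s" by metis
    have a_d: "a s = d s * N 0" for s
    proof -
      have "a s = ip (\<lambda>A. \<Sum>e\<le>k. c s e A) (ind {})"
        unfolding a_def using c by (intro ip_cong) auto
      also have "\<dots> = (\<Sum>e\<le>k. ip (c s e) (ind {}))" by (rule ip_sum_left)
      also have "\<dots> = (\<Sum>e\<le>k. if e = 0 then ip (c s 0) (ind {}) else 0)"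
      proof (intro sum.cong refl)
        fix e assume "e \<in> {..k}"
        then show "ip (c s e) (ind {}) = (if e = 0 then ip (c s 0) (ind {}) else 0)"
          using c(1)[of e s] ind_in_V[of "{}" e] by (auto simp: orth_V_def)
      qed
      also have "\<dots> = ip (c s 0) (ind {})" by simp
      also have "\<dots> = d s * N 0" by (simp add: ip_def d ind_def N_def card_K)
      finally show ?thesis .
    qed
    \<comment> \<open>Since \<open>ev (max s s') 0 = N 0 / N (max s s')\<close>, the coefficient is
      \<open>N 0 / (N s * N s')\<close>, and the double sum factors into a square.\<close>
    have "ev (max s s') 0 / N (min s s') * ip (c s 0) (c s' 0) = a s / N s * (a s' / N s')" for s s'
    proof -
      have "ip (c s 0) (c s' 0) = d s * d s' * N 0" by (simp add: ip_def d N_def card_K)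
      moreover have "N (max s s') * N (min s s') = N s * N s'" by (simp add: max_def min_def)
      ultimately show ?thesis unfolding a_d by (simp add: ev_def)
    qed
    then show ?thesis unfolding T_def Z_a power2_eq_square sum_product by simp
  qed
  have "Z = T 0 + (\<Sum>e\<in>{1..k}. T e)"
    unfolding Z_T by (subst sum.remove[of _ 0]) (auto intro!: sum.cong)
  moreover have "(\<Sum>e\<in>{1..k}. T e) \<ge> 0" using T_pos by (intro sum_nonneg) auto
  ultimately have "Z * Z \<le> Z * 1" by (simp add: T_0 power2_eq_square)
  then have "Z \<le> 1" by (cases "Z > 0") (auto dest: mult_left_le_imp_le)
  then show ?thesis by (simp add: Z_def)
qed

section \<open>Eigenvalue conditions in the range of \<open>n\<close>\<close>

context
  assumes large: "k \<ge> 2 \<Longrightarrow> 3 * k \<le> n" "k \<ge> 3 \<Longrightarrow> real k ^ 2 / 4 + 5 * real k \<le> real n"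
begin

text \<open>With \<open>y\<close> the ratio,
  \<open>(1 - y) * (n - 2 * k) = n - 2 * k - k^2 / 4\<close>. For \<open>k >= 3\<close> the summand
  \<open>5 * k\<close> pays for \<open>2 * k\<close> here and for the \<open>3 * k\<close> of the
  last claim.\<close>

lemma ratio_bounds:
  assumes "k \<ge> 2"
  shows "2 * k < n" "real k ^ 2 / (4 * (real n - 2 * real k)) \<le> 1"
    "k \<ge> 3 \<Longrightarrow> 3 * real k \<le> (1 - real k ^ 2 / (4 * (real n - 2 * real k))) * real n"
proof -
  show less: "2 * k < n" using assms large by simp
  then have pos: "real n - 2 * real k > 0" by (simp add: of_nat_diff)
  have "real k ^ 2 / 4 \<le> real n - 2 * real k"
  proof (cases "k \<ge> 3")
    case True
    then show ?thesis using large(2) by simp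
  next
    case False
    then have k: "k = 2" using assms by simp
    then have "6 \<le> n" using large(1) by simp
    then show ?thesis by (simp add: k)
  qed
  then show "real k ^ 2 / (4 * (real n - 2 * real k)) \<le> 1" using pos by (simp add: field_simps)
  assume "k \<ge> 3"
  then have "3 * real k \<le> real n - 2 * real k - real k ^ 2 / 4" using large(2) by simp
  also have "\<dots> = (1 - real k ^ 2 / (4 * (real n - 2 * real k))) * (real n - 2 * real k)"
    using pos by (simp add: field_simps)
  also have "\<dots> \<le> (1 - real k ^ 2 / (4 * (real n - 2 * real k))) * real n"
    using \<open>real k ^ 2 / (4 * (real n - 2 * real k)) \<le> 1\<close> by (intro mult_left_mono) auto
  finally show "3 * real k \<le> (1 - real k ^ 2 / (4 * (real n - 2 * real k))) * real n" .
qed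

lemma ev_0: "0 < e \<Longrightarrow> ev 0 e = 1"
  by (simp add: ev_def wilson_eigenvalue_def)

lemma ev_le_3:
  assumes "1 \<le> t" "t < e" "e \<le> k"
  shows "ev t e \<le> 3"
proof -
  have k: "k \<ge> 2" using assms by simp
  have "wilson_tail n k t e \<le> 2" using assms ratio_bounds[OF k] by (intro wilson_tail_le_2) auto
  then have "\<bar>(-1) ^ (e - t - 1) * wilson_tail n k t e\<bar> \<le> 2"
    using wilson_tail_nonneg[of n k t e] by (simp add: abs_mult)
  then show ?thesis using assms wilson_eigenvalue_eq[of t e k n] two_k_le by (simp add: ev_def)
qed

text \<open>The tail enters negatively only for even gaps: gap 2 costs at most the ratio
  \<open>y\<close>, larger even gaps at most \<open>1 / 8\<close>. The threshold
  \<open>3 * k / n\<close> is what \<open>ev_N_antimono\<close> needs.\<close>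

lemma ev_ge:
  assumes "s + 2 \<le> e" "e \<le> k"
  shows "3 * real k \<le> ev s e * real n"
proof (cases "s = 0")
  case True
  then show ?thesis using assms large(1) by (simp add: ev_0)
next
  case False
  then have k: "k \<ge> 3" using assms by simp
  have eq: "ev s e = 1 + (-1) ^ (e - s - 1) * wilson_tail n k s e"
    using False assms wilson_eigenvalue_eq[of s e k n] two_k_le by (simp add: ev_def)
  have n5: "5 * real k \<le> real n" using large(2)[OF k] zero_le_power2[of "real k"] by linarith
  note tail0 = wilson_tail_nonneg[of n k s e]
  consider "e - s = 2" | "odd (e - s)" | "even (e - s)" "e - s \<ge> 4"
  proof -
    have "e - s = 2 \<or> odd (e - s) \<or> even (e - s) \<and> 4 \<le> e - s" using assms by presburger
    then show ?thesis using that by blast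
  qed
  then show ?thesis
  proof cases
    case 1
    have "wilson_tail n k s e \<le> real k ^ 2 / (4 * (real n - 2 * real k))"
      using 1 assms ratio_bounds k by (intro wilson_tail_le_y) auto
    then have "(1 - real k ^ 2 / (4 * (real n - 2 * real k))) * real n \<le> ev s e * real n"
      unfolding eq 1 by (intro mult_right_mono) auto
    then show ?thesis using ratio_bounds(3) k by linarith
  next
    case 2
    then have "even (e - s - 1)" using assms by simp
    then have "1 \<le> ev s e" using eq tail0 by simp
    then have "1 * real n \<le> ev s e * real n" by (intro mult_right_mono) auto
    then show ?thesis using n5 by linarith
  next
    case 3
    have "wilson_tail n k s e \<le> 1 / 8"
      using 3 assms ratio_bounds k by (intro wilson_tail_le_eighth) auto
    moreover have "odd (e - s - 1)" using 3 by presburger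
    ultimately have "7 / 8 \<le> ev s e" using eq by simp
    then have "7 / 8 * real n \<le> ev s e * real n" by (intro mult_right_mono) auto
    then show ?thesis using n5 by linarith
  qed
qed

text \<open>Gaps of at least 2 follow from \<open>ev_ge\<close>; at gap 1 the tail is added with a
  positive sign.\<close>

lemma ev_pos:
  assumes "s < e" "e \<le> k"
  shows "0 < ev s e"
proof (cases "s + 2 \<le> e")
  case True
  then have "0 < ev s e * real n" using ev_ge[OF True] assms by linarith
  then show ?thesis by (simp add: zero_less_mult_iff)
next
  case False
  then have e: "e = Suc s" using assms by simp
  show ?thesis
  proof (cases "s = 0")
    case True
    then show ?thesis by (simp add: e ev_0)
  next
    case False
    then have "ev s e = 1 + wilson_tail n k s e"
      using assms e wilson_eigenvalue_eq[of s e k n] two_k_le by (simp add: ev_def)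
    then show ?thesis using wilson_tail_nonneg[of n k s e] by simp
  qed
qed

text \<open>Here \<open>N (Suc s) / N s = (k - s) / (n - s) <= k / n\<close>, while the eigenvalues
  satisfy \<open>ev (Suc s) e <= 3\<close> and \<open>ev s e >= 3 * k / n\<close>.\<close>

lemma ev_N_antimono:
  assumes "Suc s < e" "e \<le> k"
  shows "ev (Suc s) e * N (Suc s) \<le> ev s e * N s"
proof -
  have sk: "s < k" "k \<le> n" using assms two_k_le by auto
  have N: "N s > 0" "N (Suc s) > 0" using sk by (auto intro!: N_pos)
  have ns: "real (n - s) > 0" "real n > 0" using sk by auto
  have "real (k - s) * real n \<le> real k * real (n - s)"
    using sk by (simp add: of_nat_diff algebra_simps mult_right_mono)
  then have "3 * (N s * (real (k - s) * real n)) \<le> 3 * (N s * (real k * real (n - s)))"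
    using N by (intro mult_left_mono) auto
  then have "3 * N (Suc s) * (real (n - s) * real n) \<le> 3 * real k * N s * real (n - s)"
    using N_Suc[OF sk(1)] by (simp add: mult_ac)
  then have "(3 * N (Suc s) * real n) * real (n - s) \<le> (3 * real k * N s) * real (n - s)"
    by (simp only: mult_ac)
  then have "3 * N (Suc s) * real n \<le> 3 * real k * N s"
    using ns by (simp only: mult_le_cancel_right_pos)
  also have "\<dots> \<le> (ev s e * real n) * N s"
    using ev_ge[of s e] assms N by (intro mult_right_mono) auto
  finally have "(3 * N (Suc s)) * real n \<le> (ev s e * N s) * real n" by (simp only: mult_ac)
  then have "3 * N (Suc s) \<le> ev s e * N s" using ns by (simp only: mult_le_cancel_right_pos)
  moreover have "ev (Suc s) e * N (Suc s) \<le> 3 * N (Suc s)"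
    using ev_le_3[of "Suc s" e] assms N by (intro mult_right_mono) auto
  ultimately show ?thesis by linarith
qed

lemma levelled_lym_large:
  assumes "\<A> \<subseteq> K" "\<And>A. A \<in> \<A> \<Longrightarrow> lev A \<le> k"
    and "\<And>A A'. A \<in> \<A> \<Longrightarrow> A' \<in> \<A> \<Longrightarrow> max (lev A) (lev A') \<le> card (A \<inter> A')"
  shows "(\<Sum>A\<in>\<A>. 1 / N (lev A)) \<le> 1"
  using assms ev_pos ev_N_antimono by (intro levelled_lym) auto

end

end

section \<open>From cross-intersecting families to levels\<close>

text \<open>Each set \<open>A\<close> is counted \<open>card (H A)\<close> times, at most
  \<open>M_bound m (lev A) <= X / N (lev A)\<close> with \<open>X\<close> the right-hand side;
  summation against the weighted bound gives \<open>X\<close>.\<close>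

lemma cross_families_sum_le:
  fixes F :: "nat \<Rightarrow> nat \<Rightarrow> nat set set" and m :: "nat \<Rightarrow> nat"
  assumes n: "2 * k \<le> n" "k \<ge> 2 \<Longrightarrow> 3 * k \<le> n" "k \<ge> 3 \<Longrightarrow> real k ^ 2 / 4 + 5 * real k \<le> real n"
    and F: "\<And>i j. i \<in> {1..k} \<Longrightarrow> j \<in> {1..m i} \<Longrightarrow> F i j \<subseteq> nsets {1..n} k"
    and cross: "\<And>i j i' j'. i \<in> {1..k} \<Longrightarrow> j \<in> {1..m i} \<Longrightarrow> i' \<in> {1..k} \<Longrightarrow> j' \<in> {1..m i'} \<Longrightarrow>
        (i, j) \<noteq> (i', j') \<Longrightarrow> cross_intersecting (max i i') (F i j) (F i' j')"
  shows "(\<Sum>i=1..k. \<Sum>j=1..m i. card (F i j)) \<le> (MAX s\<in>{0..k}. M_bound m s * ((n - s) choose (k - s)))"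
proof -
  interpret johnson n k by unfold_locales (rule n)
  define I where "I = (SIGMA i:{1..k}. {1..m i})"
  define G where "G p = F (fst p) (snd p)" for p
  define \<A> where "\<A> = (\<Union>p\<in>I. G p)"
  define H where "H A = {p\<in>I. A \<in> G p}" for A
  \<comment> \<open>Level 0 means membership in at most one family, since
    \<open>M_bound m 0 = 1\<close>. \<open>H_k\<close> ensures that the least value exists and is at
    most \<open>k\<close>.\<close>
  define lev where "lev A = (LEAST s. card (H A) \<le> M_bound m s)" for A
  define X where "X = (MAX s\<in>{0..k}. M_bound m s * ((n - s) choose (k - s)))"
  have finI: "finite I" by (simp add: I_def)
  have G_K: "G p \<subseteq> K" if "p \<in> I" for p
    unfolding G_def K_def using that by (intro F) (auto simp: I_def)
  then have A_K: "\<A> \<subseteq> K" by (auto simp: \<A>_def)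
  then have finA: "finite \<A>" by (rule finite_subset) simp
  have G_cross: "max (fst p) (fst q) \<le> card (A \<inter> A')"
    if "p \<in> I" "q \<in> I" "p \<noteq> q" "A \<in> G p" "A' \<in> G q" for p q A A'
    using that cross[of "fst p" "snd p" "fst q" "snd q"]
    by (auto simp: I_def G_def cross_intersecting_def)
  have finH: "finite (H A)" for A using finI by (simp add: H_def)
  have H_le: "card (H A) \<le> M_bound m s" if "s \<le> k" "\<And>p. p \<in> H A \<Longrightarrow> fst p \<le> s" for A s
  proof -
    have "H A \<subseteq> (SIGMA i:{1..s}. {1..m i})" using that by (auto simp: H_def I_def)
    then have "card (H A) \<le> card (SIGMA i:{1..s}. {1..m i})" by (intro card_mono) auto
    then show ?thesis by (simp add: M_bound_def)
  qed
  have H_k: "card (H A) \<le> M_bound m k" for A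
    by (rule H_le) (auto simp: H_def I_def)
  have lev_k: "lev A \<le> k" for A unfolding lev_def by (rule Least_le) (rule H_k)
  have lev_le: "card (H A) \<le> M_bound m (lev A)" for A
    unfolding lev_def by (rule LeastI) (rule H_k)
  have lev_inter: "lev A \<le> card (A \<inter> A')" if AA': "A \<in> \<A>" "A' \<in> \<A>" for A A'
  proof (cases "lev A")
    case (Suc s)
    then have less: "M_bound m s < card (H A)"
      using not_less_Least[of s "\<lambda>s. card (H A) \<le> M_bound m s"] by (simp add: lev_def)
    have "s \<le> k" using Suc lev_k[of A] by simp
    then obtain p where p: "p \<in> H A" "Suc s \<le> fst p" using H_le[of s A] less by force
    \<comment> \<open>A second family \<open>q\<close> through \<open>A\<close> handles an
      \<open>A'\<close> taken from \<open>p\<close> itself: crossing \<open>q\<close> with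
      \<open>p\<close> still forces at least \<open>fst p\<close> common elements.\<close>
    have "card (H A) \<ge> 2" using less by (simp add: M_bound_def)
    then have "\<not> H A \<subseteq> {p}" using card_mono[of "{p}" "H A"] by auto
    then obtain q where q: "q \<in> H A" "q \<noteq> p" by auto
    obtain r where r: "r \<in> I" "A' \<in> G r" using AA' by (auto simp: \<A>_def)
    have "fst p \<le> card (A \<inter> A')"
    proof (cases "r = p")
      case True
      then show ?thesis using G_cross[of q r A A'] p q r by (auto simp: H_def)
    next
      case False
      then show ?thesis using G_cross[of p r A A'] p r by (auto simp: H_def)
    qed
    then show ?thesis using p Suc by simp
  qed auto
  have lym: "(\<Sum>A\<in>\<A>. 1 / N (lev A)) \<le> 1"
  proof (rule levelled_lym_large)
    show "max (lev A) (lev A') \<le> card (A \<inter> A')" if "A \<in> \<A>" "A' \<in> \<A>" for A A'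
      using lev_inter[of A A'] lev_inter[of A' A] that by (simp add: Int_commute)
  qed (use A_K lev_k n in auto)
  have "(\<Sum>i=1..k. \<Sum>j=1..m i. card (F i j)) = (\<Sum>p\<in>I. card (G p))"
    unfolding I_def G_def by (subst sum.Sigma) (auto simp: case_prod_beta)
  also have "\<dots> = (\<Sum>p\<in>I. \<Sum>A\<in>\<A>. of_bool (A \<in> G p))"
  proof (intro sum.cong refl)
    fix p assume "p \<in> I"
    then have "\<A> \<inter> {A. A \<in> G p} = G p" by (auto simp: \<A>_def)
    then show "card (G p) = (\<Sum>A\<in>\<A>. of_bool (A \<in> G p))"
      using finA by (simp add: of_bool_def sum.If_cases)
  qed
  also have "\<dots> = (\<Sum>A\<in>\<A>. \<Sum>p\<in>I. of_bool (A \<in> G p))" by (rule sum.swap)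
  also have "\<dots> = (\<Sum>A\<in>\<A>. card (H A))"
    using finI by (simp add: of_bool_def sum.If_cases H_def Int_def)
  finally have total: "(\<Sum>i=1..k. \<Sum>j=1..m i. card (F i j)) = (\<Sum>A\<in>\<A>. card (H A))" .
  have "real (card (H A)) \<le> real X * (1 / N (lev A))" for A
  proof -
    have "M_bound m (lev A) * ((n - lev A) choose (k - lev A)) \<le> X"
      unfolding X_def using lev_k[of A] by (intro Max_ge) auto
    then have "real (M_bound m (lev A)) * N (lev A) \<le> real X"
      unfolding N_def of_nat_mult[symmetric] by (simp only: of_nat_le_iff)
    then have "real (M_bound m (lev A)) \<le> real X / N (lev A)"
      using N_pos[OF lev_k] by (simp add: pos_le_divide_eq)
    then show ?thesis using lev_le[of A] by simp
  qed
  then have "real (\<Sum>A\<in>\<A>. card (H A)) \<le> real X * (\<Sum>A\<in>\<A>. 1 / N (lev A))"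
    unfolding of_nat_sum sum_distrib_left by (intro sum_mono)
  also have "\<dots> \<le> real X * 1" using lym by (intro mult_left_mono) auto
  finally show ?thesis unfolding total X_def[symmetric] by (simp only: of_nat_le_iff mult_1_right)
qed

theorem theorem1p3:
  "\<exists>D::real. \<forall>(k::nat) (n::nat) (m :: nat \<Rightarrow> nat) (F :: nat \<Rightarrow> nat \<Rightarrow> nat set set).
     k \<ge> 1 \<longrightarrow>
     (real n \<ge> (real k ^ 3 + 2 * real k ^ 2 + real k) / 2 \<or>
      real n \<ge> real k ^ 2 / 4 + 5 * real k + D) \<longrightarrow>
     (\<forall>i\<in>{1..k}. \<forall>j\<in>{1..m i}. F i j \<subseteq> nsets {1..n} k) \<longrightarrow>
     (\<forall>i\<in>{1..k}. \<forall>j\<in>{1..m i}. \<forall>i'\<in>{1..k}. \<forall>j'\<in>{1..m i'}.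
        (i, j) \<noteq> (i', j') \<longrightarrow> cross_intersecting (max i i') (F i j) (F i' j')) \<longrightarrow>
     (\<Sum>i=1..k. \<Sum>j=1..m i. card (F i j))
       \<le> (MAX s\<in>{0..k}. M_bound m s * ((n - s) choose (k - s)))"
proof (intro exI[of _ 0] allI impI)
  fix k n :: nat and m :: "nat \<Rightarrow> nat" and F :: "nat \<Rightarrow> nat \<Rightarrow> nat set set"
  assume k: "k \<ge> 1"
    and n: "real n \<ge> (real k ^ 3 + 2 * real k ^ 2 + real k) / 2 \<or> real n \<ge> real k ^ 2 / 4 + 5 * real k + 0"
    and F: "\<forall>i\<in>{1..k}. \<forall>j\<in>{1..m i}. F i j \<subseteq> nsets {1..n} k"
    and cross: "\<forall>i\<in>{1..k}. \<forall>j\<in>{1..m i}. \<forall>i'\<in>{1..k}. \<forall>j'\<in>{1..m i'}.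
        (i, j) \<noteq> (i', j') \<longrightarrow> cross_intersecting (max i i') (F i j) (F i' j')"
  \<comment> \<open>The cubic bound implies the quadratic one from \<open>k = 3\<close> on. At
    \<open>k = 2\<close> it gives only 9 instead of 11, but 6 is enough there; at
    \<open>k = 1\<close> only \<open>n >= 2\<close> is required.\<close>
  have big: "real k ^ 2 / 4 + 5 * real k \<le> real n" if "k \<ge> 3"
    using n
  proof
    assume *: "real n \<ge> (real k ^ 3 + 2 * real k ^ 2 + real k) / 2"
    have "3 * real k ^ 2 \<le> real k * real k ^ 2" using that by (intro mult_right_mono) auto
    moreover have "3 * real k \<le> real k * real k" using that by (intro mult_right_mono) auto
    ultimately show ?thesis using * by (simp add: power3_eq_cube power2_eq_square)
  qed simp
  have "2 * k \<le> n \<and> (k \<ge> 2 \<longrightarrow> 3 * k \<le> n)"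
  proof -
    consider "k = 1" | "k = 2" | "k \<ge> 3" using k by linarith
    then show ?thesis
    proof cases
      case 3
      then have "3 * real k \<le> real n" using big zero_le_power2[of "real k"] by linarith
      then show ?thesis by linarith
    qed (use n in auto)
  qed
  then show "(\<Sum>i=1..k. \<Sum>j=1..m i. card (F i j)) \<le> (MAX s\<in>{0..k}. M_bound m s * ((n - s) choose (k - s)))"
    using big F cross by (intro cross_families_sum_le) auto
qed

end
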